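(* The categories $\mathsf{SLata}$ (semilattices with adjunctions and their homomorphisms) and $\mathsf{RelSP}$ (RelS-spaces and adjoint-preserving relations) are dually equivalent.
   Context: **$\mathsf{SLata}$.** A semilattice is a meet-semilattice with greatest element $\mathbf{A}=\langle A,\wedge,1\rangle$, ordered by $a\le b$ iff $a=a\wedge b$; homomorphisms preserve $\wedge$ and $1$. An SLata is $\langle\mathbf{A},i,d\rangle$ with $\mathbf{A}$ a semilattice and $i,d:A\to A$ such that $i(a)\le b\iff a\le d(b)$ for all $a,b\in A$. SLata homomorphisms are semilattice homomorphisms commuting with the operations $i$ and $d$. $\mathsf{SLata}$ is the category of SLatas and SLata homomorphisms. **S-spaces.** Let $X$ be a set and $\mathcal{K}\subseteq\mathcal{P}(X)$, regarded as a subbase of a topology on $X$. Put $S(X)=\{U^c: U\in\mathcal{K}\}$ and $\mathcal{C}_{\mathcal{K}}(X)=\{\bigcap\mathcal{A}:\mathcal{A}\subseteq S(X)\}$. For $Y\subseteq X$, a family $\mathcal{J}\subseteq S(X)$ is a $Y$-family if for all $A,B\in\mathcal{J}$ there are $H\in S(X)$, $C\in\mathcal{J}$ with $Y\subseteq H$, $A\cap H\subseteq C$ and $B\cap H\subseteq C$. $\langle X,\mathcal{K}\rangle$ is an S-space if: (S1) the topology is $T_0$ and $X=\bigcup\mathcal{K}$; (S2) $\mathcal{K}$ is a subbase of compact open sets, closed under finite unions, and $\emptyset\in\mathcal{K}$; (S3) if $x\in U\cap V$ with $U,V\in\mathcal{K}$, there are $W,D\in\mathcal{K}$ with $x\notin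 W$, $x\in D$, $D\subseteq(U\cap V)\cup W$; (S4) if $Y\in\mathcal{C}_{\mathcal{K}}(X)$ and $\mathcal{J}\subseteq S(X)$ is a $Y$-family with $Y\cap A^c\neq\emptyset$ for all $A\in\mathcal{J}$, then $Y\cap\bigcap\{A^c:A\in\mathcal{J}\}\neq\emptyset$. Put $\mathrm{cl}_{\mathcal{K}}(x)=\bigcap\{U\in S(X):x\in U\}$. The dual specialization order is: $x\sqsupseteq_X y$ iff $y\in\mathrm{cl}_{\mathcal{K}}(x)$; relative to it, $\uparrow x=\mathrm{cl}_{\mathcal{K}}(x)$. **Meet-relations.** For $T\subseteq X\times Y$ write $T(x)=\{y:(x,y)\in T\}$ and $\Box_T(U)=\{x\in X:T(x)\subseteq U\}$. A meet-relation between S-spaces $\langle X_1,\mathcal{K}_1\rangle$ and $\langle X_2,\mathcal{K}_2\rangle$ is $T\subseteq X_1\times X_2$ such that $\Box_T(U)\in S(X_1)$ for all $U\in S(X_2)$, and $T(x)=\bigcap\{U\in S(X_2):T(x)\subseteq U\}$ for all $x\in X_1$. For relations $R\subseteq X_1\times X_2$, $T\subseteq X_2\times X_3$ between S-spaces, put $T*R=\{(x,z)\in X_1\times X_3:\forall U\in S(X_3)\,((T\circ R)(x)\subseteq U\Rightarrow z\in U)\}$, where $(T\circ R)(x)=\bigcup_{y\in R(x)}T(y)$. **$\mathsf{RelSP}$.** For an S-space and $U\in S(X)$ let $D_U=\{Y\in\mathcal{C}_{\mathcal{K}}(X):Y\subseteq U\}$. A relation $T\subseteq X\times X$ on an S-space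 $\langle X,\mathcal{K}\rangle$ is an A-relation if: (1) $\Box_T(U)\in S(X)$ for every $U\in S(X)$; (2) for all $U\in S(X)$, $\bigcap F_U^T\in S(X)$, where $F_U^T=\{V\in S(X):U\subseteq\Box_T(V)\}$. A RelS-space is $\langle X,\mathcal{K},T\rangle$ where $\langle X,\mathcal{K}\rangle$ is an S-space and $T\subseteq X\times X$ is an A-relation. Given RelS-spaces $\langle X,\mathcal{K}_X,T_X\rangle$, $\langle Y,\mathcal{K}_Y,T_Y\rangle$, a relation $M\subseteq X\times Y$ is adjoint-preserving if: (1) $M$ is a meet-relation; (2) $M*T_X=T_Y*M$; (3) for every $x\in X$, $U\in S(X)$ and $V\in S(Y)$: $(M(x)\in D_V\Rightarrow T_X(x)\in D_U)\Rightarrow(M(x)\in\bigcap_{W\in F_V^{T_Y}}D_W\Rightarrow\ \uparrow x\in D_U)$. $\mathsf{RelSP}$ has RelS-spaces as objects, adjoint-preserving relations as morphisms, composition $*$, and identities $\sqsupseteq_X$.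
   Formalization: Y-families are nonempty (else no S-space exists); in (3) x is quantified within each implication (else identities fail); T_X(x) is replaced by its closure (else composition fails). Stated for each set A: SLatas carried by subsets of A, RelS-spaces on subsets of P(A) whose subbase embeds in A. *)

theory Defs
  imports "HOL-Analysis.Analysis"
begin

section \<open>Categories and dual equivalence\<close>

text \<open>
  Arrows are indexed by their domain and codomain: the same raw value may belong to several
  hom-sets, and composition takes the three objects as arguments.
  \<open>Comp C a b c g f\<close> is the composite of \<open>f : a \<rightarrow> b\<close> followed by \<open>g : b \<rightarrow> c\<close>.
\<close>

record ('o, 'm) category =
  Obj :: "'o set"
  Hom :: "'o \<Rightarrow> 'o \<Rightarrow> 'm set"
  Ident :: "'o \<Rightarrow> 'm"
  Comp :: "'o \<Rightarrow> 'o \<Rightarrow> 'o \<Rightarrow> 'm \<Rightarrow> 'm \<Rightarrow> 'm"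

definition is_category :: "('o, 'm) category \<Rightarrow> bool" where
  "is_category C \<longleftrightarrow>
     (\<forall>a\<in>Obj C. Ident C a \<in> Hom C a a) \<and>
     (\<forall>a\<in>Obj C. \<forall>b\<in>Obj C. \<forall>c\<in>Obj C. \<forall>f\<in>Hom C a b. \<forall>g\<in>Hom C b c.
        Comp C a b c g f \<in> Hom C a c) \<and>
     (\<forall>a\<in>Obj C. \<forall>b\<in>Obj C. \<forall>f\<in>Hom C a b.
        Comp C a a b f (Ident C a) = f \<and> Comp C a b b (Ident C b) f = f) \<and>
     (\<forall>a\<in>Obj C. \<forall>b\<in>Obj C. \<forall>c\<in>Obj C. \<forall>d\<in>Obj C.
        \<forall>f\<in>Hom C a b. \<forall>g\<in>Hom C b c. \<forall>h\<in>Hom C c d.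
        Comp C a c d h (Comp C a b c g f) = Comp C a b d (Comp C b c d h g) f)"

definition opposite :: "('o, 'm) category \<Rightarrow> ('o, 'm) category" where
  "opposite C = \<lparr>Obj = Obj C, Hom = (\<lambda>a b. Hom C b a), Ident = Ident C,
     Comp = (\<lambda>a b c g f. Comp C c b a f g)\<rparr>"

definition full_subcategory :: "('o, 'm) category \<Rightarrow> ('o \<Rightarrow> bool) \<Rightarrow> ('o, 'm) category" where
  "full_subcategory C P = C\<lparr>Obj := {a \<in> Obj C. P a}\<rparr>"

record ('o, 'm, 'p, 'n) cat_functor =
  on_obj :: "'o \<Rightarrow> 'p"
  on_arr :: "'o \<Rightarrow> 'o \<Rightarrow> 'm \<Rightarrow> 'n"

definition is_functor ::
  "('o, 'm) category \<Rightarrow> ('p, 'n) category \<Rightarrow> ('o, 'm, 'p, 'n) cat_functor \<Rightarrow> bool" where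
  "is_functor C D F \<longleftrightarrow>
     (\<forall>a\<in>Obj C. on_obj F a \<in> Obj D) \<and>
     (\<forall>a\<in>Obj C. \<forall>b\<in>Obj C. \<forall>f\<in>Hom C a b.
        on_arr F a b f \<in> Hom D (on_obj F a) (on_obj F b)) \<and>
     (\<forall>a\<in>Obj C. on_arr F a a (Ident C a) = Ident D (on_obj F a)) \<and>
     (\<forall>a\<in>Obj C. \<forall>b\<in>Obj C. \<forall>c\<in>Obj C. \<forall>f\<in>Hom C a b. \<forall>g\<in>Hom C b c.
        on_arr F a c (Comp C a b c g f) =
        Comp D (on_obj F a) (on_obj F b) (on_obj F c) (on_arr F b c g) (on_arr F a b f))"

definition identity_functor :: "('o, 'm, 'o, 'm) cat_functor" where
  "identity_functor = \<lparr>on_obj = (\<lambda>a. a), on_arr = (\<lambda>a b f. f)\<rparr>"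

definition compose_functors ::
  "('p, 'n, 'q, 'k) cat_functor \<Rightarrow> ('o, 'm, 'p, 'n) cat_functor \<Rightarrow> ('o, 'm, 'q, 'k) cat_functor" where
  "compose_functors G F = \<lparr>on_obj = (\<lambda>a. on_obj G (on_obj F a)),
     on_arr = (\<lambda>a b f. on_arr G (on_obj F a) (on_obj F b) (on_arr F a b f))\<rparr>"

definition is_iso :: "('o, 'm) category \<Rightarrow> 'o \<Rightarrow> 'o \<Rightarrow> 'm \<Rightarrow> bool" where
  "is_iso C a b f \<longleftrightarrow> f \<in> Hom C a b \<and>
     (\<exists>g\<in>Hom C b a. Comp C a b a g f = Ident C a \<and> Comp C b a b f g = Ident C b)"

definition naturally_isomorphic ::
  "('o, 'm) category \<Rightarrow> ('p, 'n) category \<Rightarrow>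
   ('o, 'm, 'p, 'n) cat_functor \<Rightarrow> ('o, 'm, 'p, 'n) cat_functor \<Rightarrow> bool" where
  "naturally_isomorphic C D F G \<longleftrightarrow> (\<exists>\<eta>.
     (\<forall>a\<in>Obj C. is_iso D (on_obj F a) (on_obj G a) (\<eta> a)) \<and>
     (\<forall>a\<in>Obj C. \<forall>b\<in>Obj C. \<forall>f\<in>Hom C a b.
        Comp D (on_obj F a) (on_obj F b) (on_obj G b) (\<eta> b) (on_arr F a b f) =
        Comp D (on_obj F a) (on_obj G a) (on_obj G b) (on_arr G a b f) (\<eta> a)))"

definition equivalent :: "('o, 'm) category \<Rightarrow> ('p, 'n) category \<Rightarrow> bool" where
  "equivalent C D \<longleftrightarrow> is_category C \<and> is_category D \<and>
     (\<exists>F G. is_functor C D F \<and> is_functor D C G \<and>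
        naturally_isomorphic C C identity_functor (compose_functors G F) \<and>
        naturally_isomorphic D D identity_functor (compose_functors F G))"

definition dually_equivalent :: "('o, 'm) category \<Rightarrow> ('p, 'n) category \<Rightarrow> bool" where
  "dually_equivalent C D \<longleftrightarrow> equivalent (opposite C) D"


section \<open>Semilattices with adjunctions\<close>

record 'a semilat =
  elems :: "'a set"
  meet :: "'a \<Rightarrow> 'a \<Rightarrow> 'a"
  top_el :: 'a

record 'a slata = "'a semilat" +
  i_op :: "'a \<Rightarrow> 'a"
  d_op :: "'a \<Rightarrow> 'a"

definition is_semilattice :: "('a, 'z) semilat_scheme \<Rightarrow> bool" where
  "is_semilattice A \<longleftrightarrow>
     top_el A \<in> elems A \<and>
     (\<forall>a\<in>elems A. \<forall>b\<in>elems A. meet A a b \<in> elems A) \<and>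
     (\<forall>a\<in>elems A. \<forall>b\<in>elems A. \<forall>c\<in>elems A. meet A a (meet A b c) = meet A (meet A a b) c) \<and>
     (\<forall>a\<in>elems A. \<forall>b\<in>elems A. meet A a b = meet A b a) \<and>
     (\<forall>a\<in>elems A. meet A a a = a) \<and>
     (\<forall>a\<in>elems A. meet A a (top_el A) = a)"

definition sl_le :: "('a, 'z) semilat_scheme \<Rightarrow> 'a \<Rightarrow> 'a \<Rightarrow> bool" where
  "sl_le A a b \<longleftrightarrow> a = meet A a b"

definition is_slata :: "'a slata \<Rightarrow> bool" where
  "is_slata A \<longleftrightarrow> is_semilattice A \<and>
     i_op A \<in> elems A \<rightarrow> elems A \<and> d_op A \<in> elems A \<rightarrow> elems A \<and>
     (\<forall>a\<in>elems A. \<forall>b\<in>elems A. sl_le A (i_op A a) b \<longleftrightarrow> sl_le A a (d_op A b))"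

definition slata_hom :: "'a slata \<Rightarrow> 'a slata \<Rightarrow> ('a \<Rightarrow> 'a) set" where
  "slata_hom A B = {h \<in> elems A \<rightarrow>\<^sub>E elems B.
     (\<forall>a\<in>elems A. \<forall>b\<in>elems A. h (meet A a b) = meet B (h a) (h b)) \<and>
     h (top_el A) = top_el B \<and>
     (\<forall>a\<in>elems A. h (i_op A a) = i_op B (h a)) \<and>
     (\<forall>a\<in>elems A. h (d_op A a) = d_op B (h a))}"

definition SLata :: "('a slata, 'a \<Rightarrow> 'a) category" where
  "SLata = \<lparr>Obj = {A. is_slata A}, Hom = slata_hom,
     Ident = (\<lambda>A. restrict (\<lambda>a. a) (elems A)),
     Comp = (\<lambda>A B C g f. compose (elems A) g f)\<rparr>"


section \<open>S-spaces\<close>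

record 'x sspace =
  points :: "'x set"
  subbase :: "'x set set"

definition S_sets :: "('x, 'z) sspace_scheme \<Rightarrow> 'x set set" where
  "S_sets X = {points X - U | U. U \<in> subbase X}"

text \<open>
  Intersections of families of subsets are taken relative to \<open>points X\<close>, so that the
  empty family has intersection \<open>points X\<close>.
\<close>

definition C_sets :: "('x, 'z) sspace_scheme \<Rightarrow> 'x set set" where
  "C_sets X = {points X \<inter> \<Inter>\<A> | \<A>. \<A> \<subseteq> S_sets X}"

definition S_hull :: "('x, 'z) sspace_scheme \<Rightarrow> 'x set \<Rightarrow> 'x set" where
  "S_hull X Z = points X \<inter> \<Inter>{U \<in> S_sets X. Z \<subseteq> U}"

definition point_closure :: "('x, 'z) sspace_scheme \<Rightarrow> 'x \<Rightarrow> 'x set" where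
  "point_closure X x = points X \<inter> \<Inter>{U \<in> S_sets X. x \<in> U}"

text \<open>
  A \<open>Y\<close>-family has to be nonempty. If the empty family were allowed, then (S4) for
  \<open>Y = \<Inter>(S_sets X) = {}\<close> would require \<open>{}\<close> to be nonempty, and no structure could satisfy
  (S1), (S2) and (S4). For nonempty \<open>Y\<close> the empty family satisfies (S4) trivially.
\<close>

definition Y_family :: "('x, 'z) sspace_scheme \<Rightarrow> 'x set \<Rightarrow> 'x set set \<Rightarrow> bool" where
  "Y_family X Y \<J> \<longleftrightarrow> \<J> \<subseteq> S_sets X \<and> \<J> \<noteq> {} \<and>
     (\<forall>A\<in>\<J>. \<forall>B\<in>\<J>. \<exists>H\<in>S_sets X. \<exists>C\<in>\<J>. Y \<subseteq> H \<and> A \<inter> H \<subseteq> C \<and> B \<inter> H \<subseteq> C)"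

abbreviation sspace_topology :: "('x, 'z) sspace_scheme \<Rightarrow> 'x topology" where
  "sspace_topology X \<equiv> topology_generated_by (subbase X)"

definition is_sspace :: "('x, 'z) sspace_scheme \<Rightarrow> bool" where
  "is_sspace X \<longleftrightarrow>
     subbase X \<subseteq> Pow (points X) \<and>
     \<comment> \<open>(S1)\<close>
     t0_space (sspace_topology X) \<and> points X = \<Union>(subbase X) \<and>
     \<comment> \<open>(S2)\<close>
     (\<forall>U\<in>subbase X. openin (sspace_topology X) U \<and> compactin (sspace_topology X) U) \<and>
     (\<forall>U\<in>subbase X. \<forall>V\<in>subbase X. U \<union> V \<in> subbase X) \<and> {} \<in> subbase X \<and>
     \<comment> \<open>(S3)\<close>
     (\<forall>U\<in>subbase X. \<forall>V\<in>subbase X. \<forall>x\<in>U \<inter> V.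
        \<exists>W\<in>subbase X. \<exists>D\<in>subbase X. x \<notin> W \<and> x \<in> D \<and> D \<subseteq> (U \<inter> V) \<union> W) \<and>
     \<comment> \<open>(S4)\<close>
     (\<forall>Y\<in>C_sets X. \<forall>\<J>. Y_family X Y \<J> \<and> (\<forall>A\<in>\<J>. Y \<inter> (points X - A) \<noteq> {}) \<longrightarrow>
        Y \<inter> \<Inter>{points X - A | A. A \<in> \<J>} \<noteq> {})"

text \<open>The dual specialization order, as the set of pairs \<open>(x, y)\<close> with \<open>x \<sqsupseteq> y\<close>.\<close>

definition dual_spec :: "('x, 'z) sspace_scheme \<Rightarrow> ('x \<times> 'x) set" where
  "dual_spec X = {(x, y). x \<in> points X \<and> y \<in> points X \<and> y \<in> point_closure X x}"


section \<open>Meet-relations\<close>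

definition box :: "('x, 'z) sspace_scheme \<Rightarrow> ('x \<times> 'y) set \<Rightarrow> 'y set \<Rightarrow> 'x set" where
  "box X T U = {x \<in> points X. T `` {x} \<subseteq> U}"

definition meet_relation ::
  "('x, 'z) sspace_scheme \<Rightarrow> ('y, 'w) sspace_scheme \<Rightarrow> ('x \<times> 'y) set \<Rightarrow> bool" where
  "meet_relation X Y T \<longleftrightarrow> T \<subseteq> points X \<times> points Y \<and>
     (\<forall>U\<in>S_sets Y. box X T U \<in> S_sets X) \<and>
     (\<forall>x\<in>points X. T `` {x} = S_hull Y (T `` {x}))"

text \<open>\<open>star X\<^sub>1 X\<^sub>3 T R\<close> is \<open>T * R\<close>, with \<open>R\<close> (out of \<open>X\<^sub>1\<close>) applied first.\<close>

definition star ::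
  "('x, 'z) sspace_scheme \<Rightarrow> ('v, 'w) sspace_scheme \<Rightarrow>
   ('y \<times> 'v) set \<Rightarrow> ('x \<times> 'y) set \<Rightarrow> ('x \<times> 'v) set" where
  "star X\<^sub>1 X\<^sub>3 T R = {(x, z). x \<in> points X\<^sub>1 \<and> z \<in> points X\<^sub>3 \<and>
     (\<forall>U\<in>S_sets X\<^sub>3. (\<Union>y\<in>R `` {x}. T `` {y}) \<subseteq> U \<longrightarrow> z \<in> U)}"


section \<open>RelS-spaces and adjoint-preserving relations\<close>

record 'x rels_space = "'x sspace" +
  arel :: "('x \<times> 'x) set"

definition D_sets :: "('x, 'z) sspace_scheme \<Rightarrow> 'x set \<Rightarrow> 'x set set" where
  "D_sets X U = {Y \<in> C_sets X. Y \<subseteq> U}"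

definition F_sets :: "('x, 'z) sspace_scheme \<Rightarrow> ('x \<times> 'x) set \<Rightarrow> 'x set \<Rightarrow> 'x set set" where
  "F_sets X T U = {V \<in> S_sets X. U \<subseteq> box X T V}"

definition is_A_relation :: "('x, 'z) sspace_scheme \<Rightarrow> ('x \<times> 'x) set \<Rightarrow> bool" where
  "is_A_relation X T \<longleftrightarrow> T \<subseteq> points X \<times> points X \<and>
     (\<forall>U\<in>S_sets X. box X T U \<in> S_sets X) \<and>
     (\<forall>U\<in>S_sets X. points X \<inter> \<Inter>(F_sets X T U) \<in> S_sets X)"

definition is_rels_space :: "'x rels_space \<Rightarrow> bool" where
  "is_rels_space X \<longleftrightarrow> is_sspace X \<and> is_A_relation X (arel X)"

text \<open>
  In the last condition the points \<open>x\<close> are quantified inside each of the two implications, i.e.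
  it compares sets of points: if \<open>{x. M(x) \<in> D\<^sub>V} \<subseteq> {x. T(x) \<in> D\<^sub>U}\<close>, then
  \<open>{x. M(x) \<in> \<Inter>\<^sub>W D\<^sub>W} \<subseteq> {x. \<up>x \<in> D\<^sub>U}\<close>. Read pointwise in \<open>x\<close>, identities would fail it, for
  instance on the dual of the chain \<open>0 < a < 1\<close> with \<open>i(0) = 0\<close>, \<open>i(a) = i(1) = 1\<close>.

  Members of \<open>D_sets X U\<close> are intersections of members of \<open>S_sets X\<close>, but an A-relation need
  not have such values. So \<open>T(x)\<close> enters through its hull, which is \<open>T(x)\<close> itself whenever
  \<open>T(x) \<in> C_sets X\<close>. With \<open>T(x)\<close> in place of the hull the condition could hold vacuously, and
  adjoint-preserving relations would not be closed under composition.
\<close>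

definition adjoint_preserving :: "'x rels_space \<Rightarrow> 'x rels_space \<Rightarrow> ('x \<times> 'x) set \<Rightarrow> bool" where
  "adjoint_preserving X Y M \<longleftrightarrow>
     meet_relation X Y M \<and>
     star X Y M (arel X) = star X Y (arel Y) M \<and>
     (\<forall>U\<in>S_sets X. \<forall>V\<in>S_sets Y.
        (\<forall>x\<in>points X. M `` {x} \<in> D_sets Y V \<longrightarrow> S_hull X (arel X `` {x}) \<in> D_sets X U) \<longrightarrow>
        (\<forall>x\<in>points X. M `` {x} \<in> (\<Inter>W\<in>F_sets Y (arel Y) V. D_sets Y W) \<longrightarrow>
           dual_spec X `` {x} \<in> D_sets X U))"

definition RelSP :: "('x rels_space, ('x \<times> 'x) set) category" where
  "RelSP = \<lparr>Obj = {X. is_rels_space X}, Hom = (\<lambda>X Y. {M. adjoint_preserving X Y M}),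
     Ident = dual_spec,
     Comp = (\<lambda>X Y Z N M. star X Z N M)\<rparr>"

text \<open>
  No single type can host the duality without a size condition. Points of the dual space of an
  SLata are subsets of its carrier, so the dual of an SLata over \<open>'a\<close> lives over \<open>'a set\<close>;
  but a RelS-space over \<open>'a set\<close> can have a subbase too large to be
  in bijection with a subset of \<open>'a\<close>. A RelS-space is called \<open>'a\<close>-sized here if its subbase can
  be embedded into \<open>'a\<close>. Every RelS-space, over any type \<open>'x\<close>, is of this kind for \<open>'a = 'x set\<close>,
  after renaming its points \<open>x\<close> to \<open>{{x}}\<close>.
\<close>

definition sized_by :: "'a itself \<Rightarrow> ('x, 'z) sspace_scheme \<Rightarrow> bool" where
  "sized_by _ X \<longleftrightarrow> subbase X \<lesssim> (UNIV :: 'a set)"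

end

theory Submission
  imports Defs
begin

text \<open>
  Send a RelS-space \<open>X\<close> to the SLata \<open>S(X)\<close> with \<open>d = \<box>\<^sub>T\<close> and \<open>i(U) = \<Inter>F\<^sub>U\<close>, and an
  adjoint-preserving relation \<open>M\<close> to \<open>\<box>\<^sub>M\<close>. A meet-relation is determined by \<open>\<box>\<^sub>M\<close>, and the
  remaining two conditions on \<open>M\<close> say that \<open>\<box>\<^sub>M\<close> commutes with \<open>d\<close> and \<open>i\<close>. This contravariant
  functor is full because compactness lets a semilattice homomorphism be recovered as \<open>\<box>\<^sub>M\<close>, and
  essentially surjective because every SLata is isomorphic to \<open>S(X)\<close> for the space \<open>X\<close> of its
  irreducible filters.
\<close>

section \<open>Fully faithful and essentially surjective functors\<close>

text \<open>The obstacle is one of types. S-sets are sets of points, so the SLata of a space over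
  \<open>'x\<close> lives over \<open>'x set\<close>, while the category \<open>SLata\<close> fixes
  one carrier type \<open>'a\<close>. The size condition supplies an injection of
  \<open>S_sets X\<close> into \<open>'a\<close>, and the SLata is carried along it. In the other
  direction the filter space of an SLata over \<open>'a\<close> meets the size condition, because
  its subbase is indexed by elements of \<open>'a\<close>. Only the functor out of RelSP is written
  down; its quasi-inverse and both natural isomorphisms come from a general criterion. The
  isomorphism of a space with the filter space of its own SLata is thus delivered by full
  faithfulness rather than by matching points with filters. (S3) and (S4) are at work where the
  filter space is shown to be an S-space: (S3) expresses the irreducibility of its points, and (S4)
  rests on Zorn's lemma for filters that avoid a set directed modulo a given filter.\<close>

lemma Ident_in_Hom: "is_category C \<Longrightarrow> a \<in> Obj C \<Longrightarrow> Ident C a \<in> Hom C a a"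
  by (simp add: is_category_def)

lemma Comp_in_Hom:
  "is_category C \<Longrightarrow> a \<in> Obj C \<Longrightarrow> b \<in> Obj C \<Longrightarrow> c \<in> Obj C \<Longrightarrow> f \<in> Hom C a b \<Longrightarrow> g \<in> Hom C b c
    \<Longrightarrow> Comp C a b c g f \<in> Hom C a c"
  by (simp add: is_category_def)

lemma Comp_Ident_right:
  "is_category C \<Longrightarrow> a \<in> Obj C \<Longrightarrow> b \<in> Obj C \<Longrightarrow> f \<in> Hom C a b \<Longrightarrow> Comp C a a b f (Ident C a) = f"
  by (simp add: is_category_def)

lemma Comp_Ident_left:
  "is_category C \<Longrightarrow> a \<in> Obj C \<Longrightarrow> b \<in> Obj C \<Longrightarrow> f \<in> Hom C a b \<Longrightarrow> Comp C a b b (Ident C b) f = f"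
  by (simp add: is_category_def)

lemma Comp_assoc:
  "is_category C \<Longrightarrow> a \<in> Obj C \<Longrightarrow> b \<in> Obj C \<Longrightarrow> c \<in> Obj C \<Longrightarrow> d \<in> Obj C
    \<Longrightarrow> f \<in> Hom C a b \<Longrightarrow> g \<in> Hom C b c \<Longrightarrow> h \<in> Hom C c d
    \<Longrightarrow> Comp C a c d h (Comp C a b c g f) = Comp C a b d (Comp C b c d h g) f"
  by (simp add: is_category_def)

lemma equivalent_sym: "equivalent C D \<Longrightarrow> equivalent D C"
  unfolding equivalent_def by blast

text \<open>The quasi-inverse picks for each \<open>d\<close> an object \<open>g d\<close> and an
  isomorphism \<open>\<epsilon> d\<close> from \<open>d\<close> to its image under \<open>F\<close>.
  An arrow of \<open>D\<close> is conjugated by these isomorphisms and then lifted through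
  \<open>F\<close>. Equations in \<open>C\<close> are checked after applying \<open>F\<close>, since
  \<open>F\<close> is faithful.\<close>

lemma equivalent_if_fully_faithful_essentially_surjective:
  assumes C: "is_category C" and D: "is_category D" and F: "is_functor C D F"
    and ff: "\<And>a b. a \<in> Obj C \<Longrightarrow> b \<in> Obj C \<Longrightarrow>
      bij_betw (on_arr F a b) (Hom C a b) (Hom D (on_obj F a) (on_obj F b))"
    and es: "\<And>d. d \<in> Obj D \<Longrightarrow> \<exists>c\<in>Obj C. \<exists>f. is_iso D d (on_obj F c) f"
  shows "equivalent C D"
proof -
  note [intro, simp] = Ident_in_Hom[OF C] Ident_in_Hom[OF D] Comp_in_Hom[OF C] Comp_in_Hom[OF D]
  note [simp] = Comp_Ident_left[OF C] Comp_Ident_left[OF D]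
    Comp_Ident_right[OF C] Comp_Ident_right[OF D]
  have F_obj[intro, simp]: "on_obj F a \<in> Obj D" if "a \<in> Obj C" for a
    using F that by (simp add: is_functor_def)
  have F_arr[intro, simp]: "on_arr F a b f \<in> Hom D (on_obj F a) (on_obj F b)"
    if "a \<in> Obj C" "b \<in> Obj C" "f \<in> Hom C a b" for a b f
    using F that by (simp add: is_functor_def)
  have F_id[simp]: "on_arr F a a (Ident C a) = Ident D (on_obj F a)" if "a \<in> Obj C" for a
    using F that by (simp add: is_functor_def)
  have F_comp[simp]: "on_arr F a c (Comp C a b c g f) =
      Comp D (on_obj F a) (on_obj F b) (on_obj F c) (on_arr F b c g) (on_arr F a b f)"
    if "a \<in> Obj C" "b \<in> Obj C" "c \<in> Obj C" "f \<in> Hom C a b" "g \<in> Hom C b c" for a b c f g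
    using F that by (simp add: is_functor_def)
  define P where "P a b = inv_into (Hom C a b) (on_arr F a b)" for a b
  have P[intro, simp]: "P a b k \<in> Hom C a b" and FP[simp]: "on_arr F a b (P a b k) = k"
    if "a \<in> Obj C" "b \<in> Obj C" "k \<in> Hom D (on_obj F a) (on_obj F b)" for a b k
    using ff[OF that(1,2)] that(3) unfolding P_def bij_betw_def
    by (metis inv_into_into, metis f_inv_into_f)
  have faithful: "f = f'" if "on_arr F a b f = on_arr F a b f'"
    "a \<in> Obj C" "b \<in> Obj C" "f \<in> Hom C a b" "f' \<in> Hom C a b" for a b f f'
    using ff[OF that(2,3)] that by (meson bij_betw_def inj_onD)
  obtain g \<epsilon> where g[intro, simp]: "\<And>d. d \<in> Obj D \<Longrightarrow> g d \<in> Obj C"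
    and \<epsilon>_iso: "\<And>d. d \<in> Obj D \<Longrightarrow> is_iso D d (on_obj F (g d)) (\<epsilon> d)"
    using es by metis
  define H where "H d = on_obj F (g d)" for d
  have H[intro, simp]: "d \<in> Obj D \<Longrightarrow> H d \<in> Obj D" for d by (simp add: H_def)
  have \<epsilon>[intro, simp]: "\<And>d. d \<in> Obj D \<Longrightarrow> \<epsilon> d \<in> Hom D d (H d)"
    using \<epsilon>_iso unfolding is_iso_def H_def by blast
  have "\<And>d. d \<in> Obj D \<Longrightarrow> \<exists>e. e \<in> Hom D (H d) d \<and>
      Comp D d (H d) d e (\<epsilon> d) = Ident D d \<and> Comp D (H d) d (H d) (\<epsilon> d) e = Ident D (H d)"
    using \<epsilon>_iso unfolding is_iso_def H_def by blast
  then obtain \<epsilon>' where \<epsilon>'[intro, simp]: "\<And>d. d \<in> Obj D \<Longrightarrow> \<epsilon>' d \<in> Hom D (H d) d"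
    and \<epsilon>'\<epsilon>[simp]: "\<And>d. d \<in> Obj D \<Longrightarrow> Comp D d (H d) d (\<epsilon>' d) (\<epsilon> d) = Ident D d"
    and \<epsilon>\<epsilon>'[simp]: "\<And>d. d \<in> Obj D \<Longrightarrow> Comp D (H d) d (H d) (\<epsilon> d) (\<epsilon>' d) = Ident D (H d)"
    by metis
  \<comment> \<open>Having a right inverse, \<open>\<epsilon> d\<close> is epi: equations between
    arrows out of \<open>H d\<close> may be tested on \<open>d\<close>.\<close>
  have cancel: "h = k" if "Comp D d (H d) e h (\<epsilon> d) = Comp D d (H d) e k (\<epsilon> d)"
    "d \<in> Obj D" "e \<in> Obj D" "h \<in> Hom D (H d) e" "k \<in> Hom D (H d) e" for d e h k
  proof -
    have "h = Comp D (H d) d e (Comp D d (H d) e h (\<epsilon> d)) (\<epsilon>' d)"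
      using that(2-) by (simp add: Comp_assoc[OF D, symmetric])
    also have "\<dots> = k"
      unfolding that(1) using that(2-) by (simp add: Comp_assoc[OF D, symmetric])
    finally show ?thesis .
  qed
  \<comment> \<open>Conjugation is forced: by \<open>cancel\<close> it is the only arrow that makes
    \<epsilon> natural, and \<open>conj_nat\<close> is that naturality square.\<close>
  define conj where "conj d d' f = Comp D (H d) d (H d') (Comp D d d' (H d') (\<epsilon> d') f) (\<epsilon>' d)"
    for d d' f
  have conj_in[intro, simp]: "conj d d' f \<in> Hom D (H d) (H d')"
    and conj_nat: "Comp D d (H d) (H d') (conj d d' f) (\<epsilon> d) = Comp D d d' (H d') (\<epsilon> d') f"
    if "d \<in> Obj D" "d' \<in> Obj D" "f \<in> Hom D d d'" for d d' f
  proof -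
    have *: "Comp D d d' (H d') (\<epsilon> d') f \<in> Hom D d (H d')"
      using that by (intro Comp_in_Hom[OF D, of _ d']) auto
    then show "conj d d' f \<in> Hom D (H d) (H d')"
      unfolding conj_def using that by (intro Comp_in_Hom[OF D, of _ d]) auto
    show "Comp D d (H d) (H d') (conj d d' f) (\<epsilon> d) = Comp D d d' (H d') (\<epsilon> d') f"
      unfolding conj_def using * that by (simp add: Comp_assoc[OF D, symmetric])
  qed
  have conj_id: "conj d d (Ident D d) = Ident D (H d)" if "d \<in> Obj D" for d
    by (rule cancel[of d "H d"]) (use that in \<open>auto simp: conj_nat\<close>)
  have conj_comp: "conj d d'' (Comp D d d' d'' k f)
      = Comp D (H d) (H d') (H d'') (conj d' d'' k) (conj d d' f)"
    if "d \<in> Obj D" "d' \<in> Obj D" "d'' \<in> Obj D" "f \<in> Hom D d d'" "k \<in> Hom D d' d''" for d d' d'' f k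
  proof (rule cancel[of d "H d''"])
    have kf: "Comp D d d' d'' k f \<in> Hom D d d''"
      using that by (intro Comp_in_Hom[OF D, of _ d']) auto
    have "Comp D d (H d) (H d'') (Comp D (H d) (H d') (H d'') (conj d' d'' k) (conj d d' f)) (\<epsilon> d)
        = Comp D d (H d') (H d'') (conj d' d'' k) (Comp D d d' (H d') (\<epsilon> d') f)"
      using that by (simp add: Comp_assoc[OF D, symmetric] conj_nat)
    also have "\<dots> = Comp D d d' (H d'') (Comp D d' d'' (H d'') (\<epsilon> d'') k) f"
      using that by (simp add: Comp_assoc[OF D] conj_nat)
    also have "\<dots> = Comp D d (H d) (H d'') (conj d d'' (Comp D d d' d'' k f)) (\<epsilon> d)"
      using that kf by (simp add: Comp_assoc[OF D] conj_nat)
    finally show "Comp D d (H d) (H d'') (conj d d'' (Comp D d d' d'' k f)) (\<epsilon> d) =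
      Comp D d (H d) (H d'') (Comp D (H d) (H d') (H d'') (conj d' d'' k) (conj d d' f)) (\<epsilon> d)" ..
    show "conj d d'' (Comp D d d' d'' k f) \<in> Hom D (H d) (H d'')" using that kf by auto
    show "Comp D (H d) (H d') (H d'') (conj d' d'' k) (conj d d' f) \<in> Hom D (H d) (H d'')"
      using that by (intro Comp_in_Hom[OF D, of _ "H d'"]) auto
  qed (use that in auto)
  define G where "G = \<lparr>on_obj = g, on_arr = (\<lambda>d d' f. P (g d) (g d') (conj d d' f))\<rparr>"
  have G_simps[simp]: "on_obj G = g" "on_arr G d d' f = P (g d) (g d') (conj d d' f)" for d d' f
    by (simp_all add: G_def)
  note conj_in' = conj_in[unfolded H_def]
  have G_arr: "P (g d) (g d') (conj d d' f) \<in> Hom C (g d) (g d')"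
    "on_arr F (g d) (g d') (P (g d) (g d') (conj d d' f)) = conj d d' f"
    if "d \<in> Obj D" "d' \<in> Obj D" "f \<in> Hom D d d'" for d d' f
    using that by (auto intro!: P FP conj_in')
  have G: "is_functor D C G"
    unfolding is_functor_def G_simps
  proof (intro conjI ballI)
    fix d assume d: "d \<in> Obj D"
    show "P (g d) (g d) (conj d d (Ident D d)) = Ident C (g d)"
      by (rule faithful[of "g d" "g d"])
        (use d G_arr[of d d "Ident D d"] in \<open>auto simp: conj_id H_def\<close>)
  next
    fix a b c f k assume *: "a \<in> Obj D" "b \<in> Obj D" "c \<in> Obj D" "f \<in> Hom D a b" "k \<in> Hom D b c"
    have kf: "Comp D a b c k f \<in> Hom D a c"
      using * by (intro Comp_in_Hom[OF D, of _ b]) auto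
    show "P (g a) (g c) (conj a c (Comp D a b c k f)) =
       Comp C (g a) (g b) (g c) (P (g b) (g c) (conj b c k)) (P (g a) (g b) (conj a b f))"
    proof (rule faithful[of "g a" "g c"])
      show "Comp C (g a) (g b) (g c) (P (g b) (g c) (conj b c k)) (P (g a) (g b) (conj a b f))
          \<in> Hom C (g a) (g c)"
        using * by (intro Comp_in_Hom[OF C, of _ "g b"] G_arr) auto
      show "on_arr F (g a) (g c) (P (g a) (g c) (conj a c (Comp D a b c k f))) = on_arr F (g a) (g c)
          (Comp C (g a) (g b) (g c) (P (g b) (g c) (conj b c k)) (P (g a) (g b) (conj a b f)))"
        unfolding G_arr(2)[OF *(1,3) kf]
        unfolding conj_comp[OF *]
        using * by (simp add: G_arr H_def)
      show "P (g a) (g c) (conj a c (Comp D a b c k f)) \<in> Hom C (g a) (g c)"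
        by (rule G_arr(1)[OF *(1,3) kf])
    qed (use * in auto)
  qed (use G_arr in auto)
  have FG: "naturally_isomorphic D D identity_functor (compose_functors F G)"
    unfolding naturally_isomorphic_def identity_functor_def compose_functors_def
    using \<epsilon>_iso conj_nat[unfolded H_def] by (intro exI[of _ \<epsilon>]) (auto simp: G_arr)
  \<comment> \<open>The second transformation is the lift of \<epsilon> through \<open>F\<close>;
    its naturality and its inverses lift with it.\<close>
  define \<eta> where "\<eta> c = P c (g (on_obj F c)) (\<epsilon> (on_obj F c))" for c
  have \<eta>: "\<eta> c \<in> Hom C c (g (on_obj F c))" "on_arr F c (g (on_obj F c)) (\<eta> c) = \<epsilon> (on_obj F c)"
    if "c \<in> Obj C" for c
    using that \<epsilon>[unfolded H_def] by (auto simp: \<eta>_def)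
  have GF: "naturally_isomorphic C C identity_functor (compose_functors G F)"
    unfolding naturally_isomorphic_def
  proof (intro exI[of _ \<eta>] conjI ballI, simp_all add: identity_functor_def compose_functors_def)
    fix c assume c: "c \<in> Obj C"
    let ?d = "on_obj F c"
    let ?c' = "g ?d"
    let ?\<theta> = "P ?c' c (\<epsilon>' ?d)"
    have \<theta>: "?\<theta> \<in> Hom C ?c' c" "on_arr F ?c' c ?\<theta> = \<epsilon>' ?d"
      using c \<epsilon>'[unfolded H_def] by auto
    have 1: "Comp C c ?c' c ?\<theta> (\<eta> c) = Ident C c"
    proof (rule faithful[of c c])
      show "Comp C c ?c' c ?\<theta> (\<eta> c) \<in> Hom C c c"
        using c \<eta>[OF c] \<theta> by (intro Comp_in_Hom[OF C, of _ ?c']) auto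
    qed (use c \<eta>[OF c] \<theta> \<epsilon>'\<epsilon>[unfolded H_def] in auto)
    have 2: "Comp C ?c' c ?c' (\<eta> c) ?\<theta> = Ident C ?c'"
    proof (rule faithful[of ?c' ?c'])
      show "Comp C ?c' c ?c' (\<eta> c) ?\<theta> \<in> Hom C ?c' ?c'"
        using c \<eta>[OF c] \<theta> by (intro Comp_in_Hom[OF C, of _ c]) auto
    qed (use c \<eta>[OF c] \<theta> \<epsilon>\<epsilon>'[unfolded H_def] in auto)
    show "is_iso C c ?c' (\<eta> c)"
      unfolding is_iso_def using 1 2 \<eta>[OF c] \<theta> by blast
  next
    fix a b f assume *: "a \<in> Obj C" "b \<in> Obj C" "f \<in> Hom C a b"
    let ?a = "g (on_obj F a)" and ?b = "g (on_obj F b)"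
    let ?k = "P ?a ?b (conj (on_obj F a) (on_obj F b) (on_arr F a b f))"
    note k = G_arr[of "on_obj F a" "on_obj F b" "on_arr F a b f"]
    show "Comp C a b ?b (\<eta> b) f = Comp C a ?a ?b ?k (\<eta> a)"
    proof (rule faithful[of a ?b])
      show "Comp C a b ?b (\<eta> b) f \<in> Hom C a ?b"
        using * \<eta> by (intro Comp_in_Hom[OF C, of _ b]) auto
      show "Comp C a ?a ?b ?k (\<eta> a) \<in> Hom C a ?b"
        using * \<eta> k by (intro Comp_in_Hom[OF C, of _ ?a]) auto
    qed (use * \<eta> k in \<open>auto simp: conj_nat[unfolded H_def]\<close>)
  qed
  show ?thesis
    unfolding equivalent_def using C D F G FG GF by blast
qed

lemma is_category_opposite: "is_category C \<Longrightarrow> is_category (opposite C)"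
  unfolding is_category_def opposite_def by simp

lemma is_iso_opposite: "is_iso (opposite C) a b f \<longleftrightarrow> is_iso C b a f"
  unfolding is_iso_def opposite_def by auto

lemma is_category_full_subcategory: "is_category C \<Longrightarrow> is_category (full_subcategory C P)"
  unfolding is_category_def full_subcategory_def by simp


section \<open>Semilattices and isomorphisms of SLatas\<close>

lemma slata_semilattice: "is_slata A \<Longrightarrow> is_semilattice A"
  by (simp add: is_slata_def)

context
  fixes A :: "('a, 'z) semilat_scheme"
  assumes A: "is_semilattice A"
begin

lemma top_in: "top_el A \<in> elems A"
  using A unfolding is_semilattice_def by blast

lemma meet_in: "a \<in> elems A \<Longrightarrow> b \<in> elems A \<Longrightarrow> meet A a b \<in> elems A"
  using A unfolding is_semilattice_def by blast

lemma meet_assoc: "a \<in> elems A \<Longrightarrow> b \<in> elems A \<Longrightarrow> c \<in> elems A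
    \<Longrightarrow> meet A a (meet A b c) = meet A (meet A a b) c"
  using A unfolding is_semilattice_def by blast

lemma meet_commute: "a \<in> elems A \<Longrightarrow> b \<in> elems A \<Longrightarrow> meet A a b = meet A b a"
  using A unfolding is_semilattice_def by blast

lemma meet_idem: "a \<in> elems A \<Longrightarrow> meet A a a = a"
  using A unfolding is_semilattice_def by blast

lemma sl_le_refl: "a \<in> elems A \<Longrightarrow> sl_le A a a"
  by (simp add: sl_le_def meet_idem)

lemma sl_le_top: "a \<in> elems A \<Longrightarrow> sl_le A a (top_el A)"
  using A unfolding sl_le_def is_semilattice_def by metis

lemma sl_le_antisym:
  assumes "a \<in> elems A" "b \<in> elems A" "sl_le A a b" "sl_le A b a"
  shows "a = b"
  using assms meet_commute[of a b] unfolding sl_le_def by simp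

lemma sl_le_trans:
  assumes "a \<in> elems A" "b \<in> elems A" "c \<in> elems A" "sl_le A a b" "sl_le A b c"
  shows "sl_le A a c"
proof -
  have "a = meet A a (meet A b c)" using assms(4,5) unfolding sl_le_def by simp
  also have "\<dots> = meet A (meet A a b) c" using assms(1-3) by (rule meet_assoc)
  also have "meet A a b = a" using assms(4) unfolding sl_le_def by simp
  finally show ?thesis unfolding sl_le_def .
qed

lemma meet_le1: "a \<in> elems A \<Longrightarrow> b \<in> elems A \<Longrightarrow> sl_le A (meet A a b) a"
  by (simp add: sl_le_def meet_in meet_assoc meet_commute[of "meet A a b" a] meet_idem)

lemma meet_le2: "a \<in> elems A \<Longrightarrow> b \<in> elems A \<Longrightarrow> sl_le A (meet A a b) b"
  by (simp add: sl_le_def meet_assoc[symmetric] meet_idem)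

lemma le_meetI:
  assumes "a \<in> elems A" "b \<in> elems A" "c \<in> elems A" "sl_le A c a" "sl_le A c b"
  shows "sl_le A c (meet A a b)"
proof -
  have "c = meet A (meet A c a) b" using assms(4,5) unfolding sl_le_def by simp
  then show ?thesis unfolding sl_le_def using assms(1-3) meet_assoc by simp
qed

end

section \<open>The adjoint pair of an SLata\<close>

context
  fixes A :: "'a slata"
  assumes A: "is_slata A"
begin

private lemmas S = slata_semilattice[OF A]

lemma i_in: "a \<in> elems A \<Longrightarrow> i_op A a \<in> elems A"
  using A by (auto simp: is_slata_def)

lemma d_in: "a \<in> elems A \<Longrightarrow> d_op A a \<in> elems A"
  using A by (auto simp: is_slata_def)

lemma i_le_iff: "a \<in> elems A \<Longrightarrow> b \<in> elems A \<Longrightarrow> sl_le A (i_op A a) b \<longleftrightarrow> sl_le A a (d_op A b)"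
  using A by (simp add: is_slata_def)

text \<open>As a right adjoint, \<open>d_op A\<close> preserves finite meets. Together with
  \<open>d_mono\<close> and \<open>meet_d_le\<close> this makes the preimage of a filter under
  \<open>d_op A\<close> a filter again.\<close>

lemma d_top: "d_op A (top_el A) = top_el A"
proof (rule sl_le_antisym[OF S])
  show "sl_le A (top_el A) (d_op A (top_el A))"
    by (simp add: i_le_iff[symmetric] top_in[OF S] sl_le_top[OF S] i_in)
qed (simp_all add: top_in[OF S] sl_le_top[OF S] d_in)

lemma d_mono: "a \<in> elems A \<Longrightarrow> b \<in> elems A \<Longrightarrow> sl_le A a b \<Longrightarrow> sl_le A (d_op A a) (d_op A b)"
proof -
  assume *: "a \<in> elems A" "b \<in> elems A" "sl_le A a b"
  then have "sl_le A (i_op A (d_op A a)) a" by (simp add: i_le_iff d_in sl_le_refl[OF S])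
  with * have "sl_le A (i_op A (d_op A a)) b" by (auto intro: sl_le_trans[OF S, of _ a] i_in d_in)
  with * show ?thesis by (simp add: i_le_iff d_in)
qed

lemma meet_d_le:
  assumes "a \<in> elems A" "b \<in> elems A"
  shows "sl_le A (meet A (d_op A a) (d_op A b)) (d_op A (meet A a b))"
proof -
  let ?c = "meet A (d_op A a) (d_op A b)"
  have c: "?c \<in> elems A" using assms by (simp add: S meet_in d_in)
  have "sl_le A (i_op A ?c) a" "sl_le A (i_op A ?c) b"
    using assms c by (simp_all add: i_le_iff S meet_le1 meet_le2 d_in)
  then show ?thesis
    using assms c by (simp add: i_le_iff[symmetric] i_in le_meetI[OF S] meet_in[OF S])
qed

end

text \<open>Arrows of \<open>SLata\<close> stay within one type. This notion compares carriers of
  different types, such as elements with sets of filters, and leaves values off the carrier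
  free.\<close>

definition slata_iso :: "'a slata \<Rightarrow> 'b slata \<Rightarrow> ('a \<Rightarrow> 'b) \<Rightarrow> bool" where
  "slata_iso A B h \<longleftrightarrow> bij_betw h (elems A) (elems B) \<and>
     (\<forall>a\<in>elems A. \<forall>b\<in>elems A. h (meet A a b) = meet B (h a) (h b)) \<and>
     h (top_el A) = top_el B \<and>
     (\<forall>a\<in>elems A. h (i_op A a) = i_op B (h a)) \<and>
     (\<forall>a\<in>elems A. h (d_op A a) = d_op B (h a))"

text \<open>Surjectivity lets each axiom for \<open>B\<close> be read on images of elements of
  \<open>A\<close>; injectivity makes the two orders agree.\<close>

lemma slata_iso_is_slata:
  assumes A: "is_slata A" and h: "slata_iso A B h"
  shows "is_slata B"
proof -
  have im: "elems B = h ` elems A" and inj: "inj_on h (elems A)"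
    using h by (auto simp: slata_iso_def bij_betw_def)
  note S = slata_semilattice[OF A]
  have sim: "\<And>a b. a \<in> elems A \<Longrightarrow> b \<in> elems A \<Longrightarrow> meet B (h a) (h b) = h (meet A a b)"
    "top_el B = h (top_el A)"
    "\<And>a. a \<in> elems A \<Longrightarrow> i_op B (h a) = h (i_op A a)"
    "\<And>a. a \<in> elems A \<Longrightarrow> d_op B (h a) = h (d_op A a)"
    using h by (auto simp: slata_iso_def)
  have le: "sl_le B (h a) (h b) \<longleftrightarrow> sl_le A a b" if "a \<in> elems A" "b \<in> elems A" for a b
    using that inj by (simp add: sl_le_def sim meet_in[OF S] inj_on_eq_iff)
  have "is_semilattice B"
    unfolding is_semilattice_def im ball_simps
    by (auto simp: sim meet_in[OF S] top_in[OF S] meet_idem[OF S] meet_assoc[OF S]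
        sl_le_top[OF S, unfolded sl_le_def, symmetric] intro: arg_cong[OF meet_commute[OF S]])
  then show ?thesis
    unfolding is_slata_def im
    by (auto simp: sim le i_in[OF A] d_in[OF A] i_le_iff[OF A])
qed

lemma slata_iso_inv:
  assumes A: "is_slata A" and h: "slata_iso A B h"
  shows "slata_iso B A (inv_into (elems A) h)"
proof -
  have im: "elems B = h ` elems A" and inj: "inj_on h (elems A)"
    using h by (auto simp: slata_iso_def bij_betw_def)
  note S = slata_semilattice[OF A]
  have sim: "\<And>a b. a \<in> elems A \<Longrightarrow> b \<in> elems A \<Longrightarrow> meet B (h a) (h b) = h (meet A a b)"
    "top_el B = h (top_el A)"
    "\<And>a. a \<in> elems A \<Longrightarrow> i_op B (h a) = h (i_op A a)"
    "\<And>a. a \<in> elems A \<Longrightarrow> d_op B (h a) = h (d_op A a)"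
    using h by (auto simp: slata_iso_def)
  show ?thesis
    unfolding slata_iso_def
    using h bij_betw_inv_into[of h "elems A" "elems B"]
    by (auto simp: im sim inj inv_into_f_f S A meet_in top_in i_in d_in slata_iso_def)
qed

lemma slata_iso_comp:
  assumes "slata_iso A B h" "slata_iso B C k"
  shows "slata_iso A C (\<lambda>a. k (h a))"
proof -
  have "h \<in> elems A \<rightarrow> elems B" using assms by (auto simp: slata_iso_def bij_betw_def)
  then show ?thesis
    using assms bij_betw_trans[of h "elems A" "elems B" k "elems C"]
    by (auto simp: slata_iso_def o_def Pi_iff)
qed

section \<open>The category of SLatas and its isomorphisms\<close>

lemma slata_homD:
  assumes "h \<in> slata_hom A B"
  shows "h \<in> elems A \<rightarrow>\<^sub>E elems B"
    "\<And>a b. a \<in> elems A \<Longrightarrow> b \<in> elems A \<Longrightarrow> h (meet A a b) = meet B (h a) (h b)"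
    "h (top_el A) = top_el B"
    "\<And>a. a \<in> elems A \<Longrightarrow> h (i_op A a) = i_op B (h a)"
    "\<And>a. a \<in> elems A \<Longrightarrow> h (d_op A a) = d_op B (h a)"
    "\<And>a. a \<in> elems A \<Longrightarrow> h a \<in> elems B"
  using assms by (auto simp: slata_hom_def)

lemma Ident_in_slata_hom: "is_slata A \<Longrightarrow> restrict (\<lambda>a. a) (elems A) \<in> slata_hom A A"
  by (auto simp: slata_hom_def d_in i_in meet_in top_in slata_semilattice)

lemma compose_in_slata_hom:
  assumes A: "is_slata A" and f: "f \<in> slata_hom A B" and g: "g \<in> slata_hom B C"
  shows "compose (elems A) g f \<in> slata_hom A C"
proof -
  note S = slata_semilattice[OF A]
  show ?thesis
    unfolding slata_hom_def compose_def
    using slata_homD[OF f] slata_homD[OF g] meet_in[OF S] top_in[OF S] d_in[OF A] i_in[OF A]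
    by simp
qed

lemma is_category_SLata: "is_category SLata"
  unfolding is_category_def SLata_def
proof (simp, intro conjI ballI allI impI)
  fix A B and f :: "'a \<Rightarrow> 'a" assume f: "f \<in> slata_hom A B"
  show "compose (elems A) f (\<lambda>a\<in>elems A. a) = f" "compose (elems A) (\<lambda>a\<in>elems B. a) f = f"
    using slata_homD(1)[OF f] by (auto simp: compose_def fun_eq_iff PiE_iff extensional_def)
next
  fix A B C and f g h :: "'a \<Rightarrow> 'a"
  assume f: "f \<in> slata_hom A B"
  show "compose (elems A) h (compose (elems A) g f) = compose (elems A) (compose (elems B) h g) f"
    using slata_homD(6)[OF f] by (auto simp: compose_def fun_eq_iff)
qed (use Ident_in_slata_hom compose_in_slata_hom in auto)

lemma is_iso_SLata:
  assumes A: "is_slata A" and h: "slata_iso A B h"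
  shows "is_iso SLata A B (restrict h (elems A))"
proof -
  have hom: "restrict k (elems C) \<in> slata_hom C D" if "slata_iso C D k" "is_slata C"
    for C D :: "'a slata" and k
    using that
    by (auto simp: slata_hom_def slata_iso_def bij_betw_def d_in i_in meet_in top_in slata_semilattice)
  let ?k = "inv_into (elems A) h"
  have im: "elems B = h ` elems A" and inj: "inj_on h (elems A)"
    using h by (auto simp: slata_iso_def bij_betw_def)
  have "restrict h (elems A) \<in> slata_hom A B" "restrict ?k (elems B) \<in> slata_hom B A"
    using hom[OF h A] hom[OF slata_iso_inv[OF A h] slata_iso_is_slata[OF A h]] by auto
  moreover have "compose (elems A) (restrict ?k (elems B)) (restrict h (elems A))
      = restrict (\<lambda>a. a) (elems A)"
    "compose (elems B) (restrict h (elems A)) (restrict ?k (elems B)) = restrict (\<lambda>a. a) (elems B)"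
    using inj by (auto simp: compose_def im fun_eq_iff)
  ultimately show ?thesis
    unfolding is_iso_def SLata_def by auto
qed

definition transport :: "('a \<Rightarrow> 'b) \<Rightarrow> 'a slata \<Rightarrow> 'b slata" where
  "transport e A = \<lparr>elems = e ` elems A,
     meet = (\<lambda>x y. e (meet A (inv_into (elems A) e x) (inv_into (elems A) e y))),
     top_el = e (top_el A),
     i_op = (\<lambda>x. e (i_op A (inv_into (elems A) e x))),
     d_op = (\<lambda>x. e (d_op A (inv_into (elems A) e x)))\<rparr>"

lemma slata_iso_transport: "inj_on e (elems A) \<Longrightarrow> slata_iso A (transport e A) e"
  by (auto simp: slata_iso_def transport_def bij_betw_def)


section \<open>Meet-relations as semilattice homomorphisms\<close>

lemma S_sets_subset: "U \<in> S_sets X \<Longrightarrow> U \<subseteq> points X"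
  by (auto simp: S_sets_def)

lemma sspaceD:
  assumes "is_sspace X"
  shows "subbase X \<subseteq> Pow (points X)" "{} \<in> subbase X"
    "\<And>U V. U \<in> subbase X \<Longrightarrow> V \<in> subbase X \<Longrightarrow> U \<union> V \<in> subbase X"
    "\<And>U. U \<in> subbase X \<Longrightarrow> openin (sspace_topology X) U"
    "\<And>U. U \<in> subbase X \<Longrightarrow> compactin (sspace_topology X) U"
proof -
  note X = assms[unfolded is_sspace_def]
  show "subbase X \<subseteq> Pow (points X)" using X by (elim conjE) assumption
  show "{} \<in> subbase X" using X by (elim conjE) assumption
  have "\<forall>U\<in>subbase X. \<forall>V\<in>subbase X. U \<union> V \<in> subbase X" using X by (elim conjE) assumption
  then show "\<And>U V. U \<in> subbase X \<Longrightarrow> V \<in> subbase X \<Longrightarrow> U \<union> V \<in> subbase X" by blast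
  have "\<forall>U\<in>subbase X. openin (sspace_topology X) U \<and> compactin (sspace_topology X) U"
    using X by (elim conjE) assumption
  then show "\<And>U. U \<in> subbase X \<Longrightarrow> openin (sspace_topology X) U"
    "\<And>U. U \<in> subbase X \<Longrightarrow> compactin (sspace_topology X) U" by blast+
qed

lemma points_in_S_sets:
  assumes "is_sspace X"
  shows "points X \<in> S_sets X"
proof -
  have "points X = points X - {}" by simp
  then show ?thesis using sspaceD(2)[OF assms] unfolding S_sets_def by blast
qed

lemma Int_in_S_sets:
  assumes "is_sspace X" "U \<in> S_sets X" "V \<in> S_sets X"
  shows "U \<inter> V \<in> S_sets X"
proof -
  obtain A B where A: "U = points X - A" "A \<in> subbase X" and B: "V = points X - B" "B \<in> subbase X"
    using assms unfolding S_sets_def by blast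
  have "U \<inter> V = points X - (A \<union> B)" using A(1) B(1) by blast
  moreover have "A \<union> B \<in> subbase X" by (rule sspaceD(3)[OF assms(1) A(2) B(2)])
  ultimately show ?thesis unfolding S_sets_def by blast
qed

lemma S_hull_subset_iff: "U \<in> S_sets X \<Longrightarrow> Z \<subseteq> points X \<Longrightarrow> S_hull X Z \<subseteq> U \<longleftrightarrow> Z \<subseteq> U"
  by (auto simp: S_hull_def)

lemma S_hull_in_C_sets: "S_hull X Z \<in> C_sets X"
  unfolding S_hull_def C_sets_def by blast

lemma S_hull_S_hull: "Z \<subseteq> points X \<Longrightarrow> S_hull X (S_hull X Z) = S_hull X Z"
  by (auto simp: S_hull_def)

lemma box_mono: "U \<subseteq> V \<Longrightarrow> box X M U \<subseteq> box X M V"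
  by (auto simp: box_def)

lemma box_Int: "box X M (U \<inter> V) = box X M U \<inter> box X M V"
  by (auto simp: box_def)

lemma box_points: "M \<subseteq> points X \<times> points Y \<Longrightarrow> box X M (points Y) = points X"
  by (auto simp: box_def)

lemma meet_relationD:
  assumes "meet_relation X Y M"
  shows "M \<subseteq> points X \<times> points Y"
    "\<And>U. U \<in> S_sets Y \<Longrightarrow> box X M U \<in> S_sets X"
    "\<And>x. x \<in> points X \<Longrightarrow> S_hull Y (M `` {x}) = M `` {x}"
  using assms unfolding meet_relation_def by (blast, blast, metis)

text \<open>Each value of a meet-relation is its own hull, and a hull depends only on which S-sets
  contain the value. The boxes record exactly this.\<close>

lemma meet_relation_eqI:
  assumes M: "meet_relation X Y M" and N: "meet_relation X Y N"
    and eq: "\<And>U. U \<in> S_sets Y \<Longrightarrow> box X M U = box X N U"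
  shows "M = N"
proof -
  have "M `` {x} = N `` {x}" for x
  proof (cases "x \<in> points X")
    case True
    have "M `` {x} \<subseteq> U \<longleftrightarrow> N `` {x} \<subseteq> U" if "U \<in> S_sets Y" for U
      using eq[OF that] True by (auto simp: box_def)
    then have "{U \<in> S_sets Y. M `` {x} \<subseteq> U} = {U \<in> S_sets Y. N `` {x} \<subseteq> U}" by blast
    then have "S_hull Y (M `` {x}) = S_hull Y (N `` {x})" by (simp only: S_hull_def)
    then show ?thesis using True meet_relationD(3)[OF M] meet_relationD(3)[OF N] by simp
  next
    case False
    then show ?thesis using meet_relationD(1)[OF M] meet_relationD(1)[OF N] by auto
  qed
  then have "(x, y) \<in> M \<longleftrightarrow> (x, y) \<in> N" for x y by (metis Image_singleton_iff)
  then show ?thesis by (simp add: set_eq_iff split_paired_all)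
qed

section \<open>Composition of relations\<close>

lemma star_Image: "x \<in> points X \<Longrightarrow> star X Z T R `` {x} = S_hull Z ((R O T) `` {x})"
  by (auto simp: star_def S_hull_def)

text \<open>Passing to the hull does not change which S-sets contain a set, so \<open>star\<close>
  turns into composition of box maps, in reverse order.\<close>

lemma box_star:
  assumes "R \<subseteq> points X \<times> points Y" "T \<subseteq> points Y \<times> points Z" "U \<in> S_sets Z"
  shows "box X (star X Z T R) U = box X R (box Y T U)"
proof -
  have "S_hull Z ((R O T) `` {x}) \<subseteq> U \<longleftrightarrow> R `` {x} \<subseteq> box Y T U" for x
  proof -
    have "S_hull Z ((R O T) `` {x}) \<subseteq> U \<longleftrightarrow> (R O T) `` {x} \<subseteq> U"
      using assms by (intro S_hull_subset_iff) auto
    also have "\<dots> \<longleftrightarrow> R `` {x} \<subseteq> box Y T U"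
      using assms by (auto simp: box_def)
    finally show ?thesis .
  qed
  then have "star X Z T R `` {x} \<subseteq> U \<longleftrightarrow> R `` {x} \<subseteq> box Y T U" if "x \<in> points X" for x
    using that by (simp only: star_Image)
  then show ?thesis
    unfolding box_def[of X] by (intro Collect_cong conj_cong refl)
qed

text \<open>Stated through boxes rather than for meet-relations because in
  \<open>adjoint_preserving_iff\<close> one factor is an A-relation. That the values are hulls is
  built into \<open>star\<close>.\<close>

lemma meet_relation_star:
  assumes "R \<subseteq> points X \<times> points Y" "T \<subseteq> points Y \<times> points Z"
    and "\<And>U. U \<in> S_sets Y \<Longrightarrow> box X R U \<in> S_sets X"
    and "\<And>U. U \<in> S_sets Z \<Longrightarrow> box Y T U \<in> S_sets Y"
  shows "meet_relation X Z (star X Z T R)"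
  unfolding meet_relation_def
proof (intro conjI ballI)
  show "star X Z T R \<subseteq> points X \<times> points Z" by (auto simp: star_def)
  show "box X (star X Z T R) U \<in> S_sets X" if "U \<in> S_sets Z" for U
    using assms that by (simp add: box_star)
  show "star X Z T R `` {x} = S_hull Z (star X Z T R `` {x})" if "x \<in> points X" for x
  proof -
    have "(R O T) `` {x} \<subseteq> points Z" using assms(2) by auto
    with that show ?thesis by (simp add: star_Image S_hull_S_hull)
  qed
qed

section \<open>Compactness and the relation induced by a homomorphism\<close>

lemma Inter_in_filter:
  assumes "finite \<B>" "\<B> \<noteq> {}" "\<B> \<subseteq> \<F>" and "\<And>V W. V \<in> \<F> \<Longrightarrow> W \<in> \<F> \<Longrightarrow> V \<inter> W \<in> \<F>"
  shows "\<Inter>\<B> \<in> \<F>"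
  using assms(1-3) by (induction rule: finite_ne_induct) (use assms(4) in auto)

text \<open>
  This is where compactness enters: \<open>\<Inter>\<F> \<subseteq> U\<close> says that the complements of members of \<open>\<F>\<close>
  cover the compact set \<open>points X - U\<close>.
\<close>

lemma filter_of_S_sets_closed:
  assumes X: "is_sspace X" and F: "\<F> \<subseteq> S_sets X" "points X \<in> \<F>"
    and Int: "\<And>V W. V \<in> \<F> \<Longrightarrow> W \<in> \<F> \<Longrightarrow> V \<inter> W \<in> \<F>"
    and up: "\<And>V W. V \<in> \<F> \<Longrightarrow> W \<in> S_sets X \<Longrightarrow> V \<subseteq> W \<Longrightarrow> W \<in> \<F>"
    and U: "U \<in> S_sets X" "points X \<inter> \<Inter>\<F> \<subseteq> U"
  shows "U \<in> \<F>"
proof -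
  let ?\<C> = "(\<lambda>V. points X - V) ` \<F>"
  have compl: "points X - V \<in> subbase X" if V: "V \<in> S_sets X" for V
  proof -
    obtain B where "B \<in> subbase X" "V = points X - B" using V unfolding S_sets_def by blast
    with sspaceD(1)[OF X] have "points X - V = B" by blast
    with \<open>B \<in> subbase X\<close> show ?thesis by simp
  qed
  have "compactin (sspace_topology X) (points X - U)"
    by (rule sspaceD(5)[OF X compl[OF U(1)]])
  moreover have "\<forall>C\<in>?\<C>. openin (sspace_topology X) C"
    using sspaceD(4)[OF X] compl F(1) by blast
  moreover have "points X - U \<subseteq> \<Union>?\<C>" using U(2) by blast
  ultimately obtain \<D> where "finite \<D>" "\<D> \<subseteq> ?\<C>" "points X - U \<subseteq> \<Union>\<D>"
    unfolding compactin_def by blast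
  then obtain \<B> where B: "finite \<B>" "\<B> \<subseteq> \<F>" "points X - U \<subseteq> \<Union>((\<lambda>V. points X - V) ` \<B>)"
    by (metis finite_subset_image)
  \<comment> \<open>The finite subcover may be empty; \<open>points X\<close> keeps the family
    nonempty and its intersection inside the space.\<close>
  have "\<Inter>(insert (points X) \<B>) \<in> \<F>"
    using B F(2) by (intro Inter_in_filter) (auto intro: Int)
  moreover have "\<Inter>(insert (points X) \<B>) \<subseteq> U" using B(3) by blast
  ultimately show ?thesis using up U(1) by blast
qed

text \<open>The value at \<open>x\<close> is the intersection of all S-sets \<open>U\<close> with
  \<open>x\<close> in \<open>h U\<close>: the largest value compatible with
  \<open>h U \<subseteq> box X M U\<close> for all \<open>U\<close>.\<close>

definition hom_relation ::
  "('x, 'z) sspace_scheme \<Rightarrow> ('y, 'w) sspace_scheme \<Rightarrow> ('y set \<Rightarrow> 'x set) \<Rightarrow> ('x \<times> 'y) set" where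
  "hom_relation X Y h = {(x, y). x \<in> points X \<and> y \<in> points Y \<and> (\<forall>U\<in>S_sets Y. x \<in> h U \<longrightarrow> y \<in> U)}"

context
  fixes X :: "('x, 'z) sspace_scheme" and Y :: "('y, 'w) sspace_scheme" and h :: "'y set \<Rightarrow> 'x set"
  assumes Y: "is_sspace Y"
    and h_in: "\<And>U. U \<in> S_sets Y \<Longrightarrow> h U \<in> S_sets X"
    and h_Int: "\<And>U V. U \<in> S_sets Y \<Longrightarrow> V \<in> S_sets Y \<Longrightarrow> h (U \<inter> V) = h U \<inter> h V"
    and h_points: "h (points Y) = points X"
begin

text \<open>The S-sets \<open>V\<close> with \<open>x\<close> in \<open>h V\<close> form a filter
  whose intersection is the value of the relation at \<open>x\<close>. If \<open>U\<close> contains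
  this intersection, compactness puts \<open>U\<close> into the filter.\<close>

lemma box_hom_relation:
  assumes U: "U \<in> S_sets Y"
  shows "box X (hom_relation X Y h) U = h U"
proof (intro equalityI subsetI)
  fix x assume x: "x \<in> box X (hom_relation X Y h) U"
  then have xX: "x \<in> points X" by (simp add: box_def)
  let ?\<F> = "{V \<in> S_sets Y. x \<in> h V}"
  have "U \<in> ?\<F>"
  proof (rule filter_of_S_sets_closed[OF Y])
    show "W \<in> ?\<F>" if "V \<in> ?\<F>" "W \<in> S_sets Y" "V \<subseteq> W" for V W
    proof -
      \<comment> \<open>Preservation of binary intersections makes \<open>h\<close>
        monotone.\<close>
      have "h V \<inter> h W = h V" using h_Int[of V W] that by (simp add: inf.absorb1)
      with that show ?thesis by blast
    qed
    show "points Y \<inter> \<Inter>?\<F> \<subseteq> U" using x xX by (auto simp: box_def hom_relation_def)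
  qed (use U xX points_in_S_sets[OF Y] Int_in_S_sets[OF Y] h_Int h_points in auto)
  then show "x \<in> h U" by simp
next
  fix x assume "x \<in> h U"
  then show "x \<in> box X (hom_relation X Y h) U"
    using U S_sets_subset[OF h_in[OF U]] by (auto simp: box_def hom_relation_def)
qed

lemma meet_relation_hom_relation: "meet_relation X Y (hom_relation X Y h)"
  unfolding meet_relation_def
proof (intro conjI ballI)
  show "box X (hom_relation X Y h) U \<in> S_sets X" if "U \<in> S_sets Y" for U
    using that by (simp add: box_hom_relation h_in)
  show "hom_relation X Y h `` {x} = S_hull Y (hom_relation X Y h `` {x})" if "x \<in> points X" for x
    using that by (auto simp: hom_relation_def S_hull_def)
qed (auto simp: hom_relation_def)

end


section \<open>The SLata of a RelS-space\<close>

text \<open>The left adjoint of the box on S-sets. The second condition on A-relations says that its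
  values are again S-sets.\<close>

definition ladj :: "'x rels_space \<Rightarrow> 'x set \<Rightarrow> 'x set" where
  "ladj X U = points X \<inter> \<Inter>(F_sets X (arel X) U)"

definition slata_of :: "'x rels_space \<Rightarrow> 'x set slata" where
  "slata_of X = \<lparr>elems = S_sets X, meet = (\<inter>), top_el = points X,
     i_op = ladj X, d_op = box X (arel X)\<rparr>"

lemma slata_of_simps [simp]:
  "elems (slata_of X) = S_sets X" "meet (slata_of X) = (\<inter>)" "top_el (slata_of X) = points X"
  "i_op (slata_of X) = ladj X" "d_op (slata_of X) = box X (arel X)"
  by (simp_all add: slata_of_def)

lemma rels_spaceD:
  assumes "is_rels_space X"
  shows "is_sspace X" "arel X \<subseteq> points X \<times> points X"
    "\<And>U. U \<in> S_sets X \<Longrightarrow> box X (arel X) U \<in> S_sets X"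
    "\<And>U. U \<in> S_sets X \<Longrightarrow> ladj X U \<in> S_sets X"
  using assms by (simp_all add: is_rels_space_def is_A_relation_def ladj_def)

text \<open>The box commutes with intersections, which gives the unit
  \<open>U \<subseteq> box X (arel X) (ladj X U)\<close>. Conversely, \<open>V\<close> is one of the
  sets being intersected.\<close>

lemma ladj_subset_iff:
  assumes X: "is_rels_space X" and U: "U \<in> S_sets X" and V: "V \<in> S_sets X"
  shows "ladj X U \<subseteq> V \<longleftrightarrow> U \<subseteq> box X (arel X) V"
proof
  assume "ladj X U \<subseteq> V"
  moreover have "U \<subseteq> box X (arel X) (ladj X U)"
  proof
    fix x assume x: "x \<in> U"
    have "y \<in> V" if "(x, y) \<in> arel X" "V \<in> F_sets X (arel X) U" for y V
      using that x by (auto simp: F_sets_def box_def)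
    then have "arel X `` {x} \<subseteq> ladj X U"
      using Image_subset[OF rels_spaceD(2)[OF X], of "{x}"] unfolding ladj_def by blast
    then show "x \<in> box X (arel X) (ladj X U)"
      using x S_sets_subset[OF U] unfolding box_def by blast
  qed
  ultimately show "U \<subseteq> box X (arel X) V"
    using box_mono[of "ladj X U" V X "arel X"] by (meson order_trans)
next
  assume "U \<subseteq> box X (arel X) V"
  then have "V \<in> F_sets X (arel X) U" using V by (simp add: F_sets_def)
  then show "ladj X U \<subseteq> V" unfolding ladj_def by blast
qed

lemma is_slata_slata_of:
  assumes X: "is_rels_space X"
  shows "is_slata (slata_of X)"
proof -
  have "is_semilattice (slata_of X)"
    using points_in_S_sets[OF rels_spaceD(1)[OF X]] Int_in_S_sets[OF rels_spaceD(1)[OF X]]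
    by (auto simp: is_semilattice_def dest: S_sets_subset)
  moreover have "sl_le (slata_of X) U V \<longleftrightarrow> U \<subseteq> V" for U V
    by (auto simp: sl_le_def)
  ultimately show ?thesis
    using rels_spaceD(3,4)[OF X] ladj_subset_iff[OF X] by (auto simp: is_slata_def)
qed

section \<open>Identity relations\<close>

lemma dual_spec_Image: "x \<in> points X \<Longrightarrow> dual_spec X `` {x} = point_closure X x"
  by (auto simp: dual_spec_def point_closure_def)

lemma point_closure_in_C_sets: "point_closure X x \<in> C_sets X"
  unfolding point_closure_def C_sets_def by blast

lemma point_closure_subset_iff:
  "U \<in> S_sets X \<Longrightarrow> x \<in> points X \<Longrightarrow> point_closure X x \<subseteq> U \<longleftrightarrow> x \<in> U"
  by (auto simp: point_closure_def)

text \<open>An S-set contains the closure of each of its points, so the identity relation induces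
  the identity map.\<close>

lemma box_dual_spec: "U \<in> S_sets X \<Longrightarrow> box X (dual_spec X) U = U"
  using S_sets_subset[of U X]
  by (auto simp add: box_def dual_spec_Image point_closure_subset_iff
      simp del: Image_singleton_iff cong: conj_cong)

lemma meet_relation_dual_spec: "meet_relation X X (dual_spec X)"
  unfolding meet_relation_def
proof (intro conjI ballI)
  show "dual_spec X `` {x} = S_hull X (dual_spec X `` {x})" if "x \<in> points X" for x
    using that by (simp add: dual_spec_Image) (auto simp: point_closure_def S_hull_def)
qed (auto simp: dual_spec_def box_dual_spec[unfolded dual_spec_def])

text \<open>Both stars are meet-relations, so their equality is tested on boxes. The third condition
  says that every S-set \<open>U\<close> above \<open>ladj X (box X M V)\<close> is above
  \<open>box X M (ladj Y V)\<close>. This amounts to one inclusion between these two sets; the other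
  follows from commutation with the boxes of the A-relations.\<close>

lemma adjoint_preserving_iff:
  assumes X: "is_rels_space X" and Y: "is_rels_space Y"
  shows "adjoint_preserving X Y M \<longleftrightarrow> meet_relation X Y M \<and>
     (\<forall>V\<in>S_sets Y. box X M (box Y (arel Y) V) = box X (arel X) (box X M V)) \<and>
     (\<forall>V\<in>S_sets Y. box X M (ladj Y V) = ladj X (box X M V))"
proof (cases "meet_relation X Y M")
  case False
  then show ?thesis by (simp add: adjoint_preserving_def)
next
  case M: True
  note RX = rels_spaceD[OF X] and RY = rels_spaceD[OF Y] and MD = meet_relationD[OF M]
  have star_eq: "star X Y M (arel X) = star X Y (arel Y) M \<longleftrightarrow>
     (\<forall>V\<in>S_sets Y. box X M (box Y (arel Y) V) = box X (arel X) (box X M V))"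
  proof
    assume eq: "star X Y M (arel X) = star X Y (arel Y) M"
    show "\<forall>V\<in>S_sets Y. box X M (box Y (arel Y) V) = box X (arel X) (box X M V)"
    proof
      fix V assume "V \<in> S_sets Y"
      from box_star[OF RX(2) MD(1) this] box_star[OF MD(1) RY(2) this]
      show "box X M (box Y (arel Y) V) = box X (arel X) (box X M V)" unfolding eq by simp
    qed
  next
    assume comm: "\<forall>V\<in>S_sets Y. box X M (box Y (arel Y) V) = box X (arel X) (box X M V)"
    show "star X Y M (arel X) = star X Y (arel Y) M"
    proof (rule meet_relation_eqI)
      show "meet_relation X Y (star X Y M (arel X))"
        by (rule meet_relation_star[OF RX(2) MD(1) RX(3) MD(2)])
      show "meet_relation X Y (star X Y (arel Y) M)"
        by (rule meet_relation_star[OF MD(1) RY(2) MD(2) RY(3)])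
    qed (use comm in \<open>simp add: box_star[OF RX(2) MD(1)] box_star[OF MD(1) RY(2)]\<close>)
  qed
  have M_D: "M `` {x} \<in> D_sets Y W \<longleftrightarrow> M `` {x} \<subseteq> W" if "x \<in> points X" for x W
    using S_hull_in_C_sets[of Y "M `` {x}"] unfolding MD(3)[OF that] D_sets_def by blast
  \<comment> \<open>An S-set contains the hull of a value of \<open>arel X\<close> exactly when it
    contains the value, so the premise compares two boxes.\<close>
  have 1: "(\<forall>x\<in>points X. M `` {x} \<in> D_sets Y V \<longrightarrow> S_hull X (arel X `` {x}) \<in> D_sets X U)
      \<longleftrightarrow> box X M V \<subseteq> box X (arel X) U" if "U \<in> S_sets X" for U V
  proof -
    have "S_hull X (arel X `` {x}) \<in> D_sets X U \<longleftrightarrow> arel X `` {x} \<subseteq> U" for x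
      using S_hull_subset_iff[OF that, of "arel X `` {x}"] Image_subset[OF RX(2)] S_hull_in_C_sets
      by (auto simp only: D_sets_def mem_Collect_eq)
    then show ?thesis unfolding box_def using M_D by blast
  qed
  have 2: "(\<forall>x\<in>points X. M `` {x} \<in> (\<Inter>W\<in>F_sets Y (arel Y) V. D_sets Y W) \<longrightarrow>
      dual_spec X `` {x} \<in> D_sets X U) \<longleftrightarrow> box X M (ladj Y V) \<subseteq> U"
    if "U \<in> S_sets X" for U V
  proof -
    have "M `` {x} \<in> (\<Inter>W\<in>F_sets Y (arel Y) V. D_sets Y W) \<longleftrightarrow> M `` {x} \<subseteq> ladj Y V"
      if "x \<in> points X" for x
      using M_D[OF that] Image_subset[OF MD(1)] unfolding ladj_def by blast
    moreover have "dual_spec X `` {x} \<in> D_sets X U \<longleftrightarrow> x \<in> U" if "x \<in> points X" for x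
      using that \<open>U \<in> S_sets X\<close>
      by (simp add: dual_spec_Image D_sets_def point_closure_in_C_sets point_closure_subset_iff)
    ultimately show ?thesis unfolding box_def by blast
  qed
  have 3: "adjoint_preserving X Y M \<longleftrightarrow>
      (\<forall>V\<in>S_sets Y. box X M (box Y (arel Y) V) = box X (arel X) (box X M V)) \<and>
      (\<forall>U\<in>S_sets X. \<forall>V\<in>S_sets Y. ladj X (box X M V) \<subseteq> U \<longrightarrow> box X M (ladj Y V) \<subseteq> U)"
    unfolding adjoint_preserving_def star_eq
    by (simp only: M 1 2 MD(2) ladj_subset_iff[OF X] simp_thms cong: ball_cong)
  \<comment> \<open>Apply the box of \<open>M\<close> to the unit of the adjunction on
    \<open>Y\<close>, commute, and transpose along the adjunction on \<open>X\<close>.\<close>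
  have ge: "ladj X (box X M V) \<subseteq> box X M (ladj Y V)"
    if V: "V \<in> S_sets Y"
      and comm: "\<forall>V\<in>S_sets Y. box X M (box Y (arel Y) V) = box X (arel X) (box X M V)" for V
  proof -
    have "V \<subseteq> box Y (arel Y) (ladj Y V)"
      using ladj_subset_iff[OF Y V RY(4)[OF V]] by blast
    then have "box X M V \<subseteq> box X (arel X) (box X M (ladj Y V))"
      using box_mono[of V "box Y (arel Y) (ladj Y V)" X M] unfolding bspec[OF comm RY(4)[OF V]]
      by blast
    then show ?thesis by (rule iffD2[OF ladj_subset_iff[OF X MD(2)[OF V] MD(2)[OF RY(4)[OF V]]]])
  qed
  \<comment> \<open>From left to right, take \<open>U = ladj X (box X M V)\<close>, which is an
    S-set.\<close>
  have 4: "(\<forall>U\<in>S_sets X. \<forall>V\<in>S_sets Y. ladj X (box X M V) \<subseteq> U \<longrightarrow> box X M (ladj Y V) \<subseteq> U)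
      \<longleftrightarrow> (\<forall>V\<in>S_sets Y. box X M (ladj Y V) \<subseteq> ladj X (box X M V))"
    using RX(4)[OF MD(2)] by blast
  show ?thesis
  proof (cases "\<forall>V\<in>S_sets Y. box X M (box Y (arel Y) V) = box X (arel X) (box X M V)")
    case True
    have "(\<forall>V\<in>S_sets Y. box X M (ladj Y V) \<subseteq> ladj X (box X M V))
        \<longleftrightarrow> (\<forall>V\<in>S_sets Y. box X M (ladj Y V) = ladj X (box X M V))"
      using ge[OF _ True] by blast
    then show ?thesis unfolding 3 4 using M True by blast
  next
    case False
    then show ?thesis unfolding 3 by blast
  qed
qed

lemma adjoint_preserving_star:
  assumes X: "is_rels_space X" and Y: "is_rels_space Y" and Z: "is_rels_space Z"
    and M: "adjoint_preserving X Y M" and N: "adjoint_preserving Y Z N"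
  shows "adjoint_preserving X Z (star X Z N M)"
    and "\<And>U. U \<in> S_sets Z \<Longrightarrow> box X (star X Z N M) U = box X M (box Y N U)"
proof -
  note MM = M[unfolded adjoint_preserving_iff[OF X Y]] and NN = N[unfolded adjoint_preserving_iff[OF Y Z]]
  note MD = meet_relationD[OF MM[THEN conjunct1]] and ND = meet_relationD[OF NN[THEN conjunct1]]
  show box: "box X (star X Z N M) U = box X M (box Y N U)" if "U \<in> S_sets Z" for U
    using that by (rule box_star[OF MD(1) ND(1)])
  show "adjoint_preserving X Z (star X Z N M)"
    unfolding adjoint_preserving_iff[OF X Z]
    using MM NN meet_relation_star[OF MD(1) ND(1)] MD(2) ND(2) rels_spaceD(3,4)[OF Z] by (simp add: box)
qed

lemma adjoint_preserving_eqI: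
  assumes "adjoint_preserving X Y M" "adjoint_preserving X Y N"
    and "\<And>U. U \<in> S_sets Y \<Longrightarrow> box X M U = box X N U"
  shows "M = N"
  using assms by (intro meet_relation_eqI) (auto simp: adjoint_preserving_def)

lemma adjoint_preserving_dual_spec: "is_rels_space X \<Longrightarrow> adjoint_preserving X X (dual_spec X)"
  by (simp add: adjoint_preserving_iff meet_relation_dual_spec box_dual_spec rels_spaceD)

lemma adjoint_preserving_box:
  "adjoint_preserving X Y M \<Longrightarrow> U \<in> S_sets Y \<Longrightarrow> box X M U \<in> S_sets X"
  by (rule meet_relationD(2)) (simp_all add: adjoint_preserving_def)

text \<open>A morphism is determined by its box map and \<open>star\<close> becomes composition of
  these, so the laws reduce to those of composing functions.\<close>

lemma is_category_RelSP: "is_category RelSP"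
  unfolding is_category_def RelSP_def
proof (simp add: adjoint_preserving_dual_spec adjoint_preserving_star(1), intro conjI allI impI)
  fix X Y :: "'x rels_space" and M
  assume *: "is_rels_space X" "is_rels_space Y" "adjoint_preserving X Y M"
  note ds = adjoint_preserving_dual_spec[OF *(1)] adjoint_preserving_dual_spec[OF *(2)]
  show "star X Y M (dual_spec X) = M"
    using adjoint_preserving_star[OF *(1,1,2) ds(1) *(3)] *(3) adjoint_preserving_box[OF *(3)]
    by (intro adjoint_preserving_eqI) (simp_all add: box_dual_spec)
  show "star X Y (dual_spec Y) M = M"
    using adjoint_preserving_star[OF *(1,2,2,3) ds(2)] *(3)
    by (intro adjoint_preserving_eqI) (simp_all add: box_dual_spec)
next
  fix W X Y Z :: "'x rels_space" and L M N
  assume *: "is_rels_space W" "is_rels_space X" "is_rels_space Y" "is_rels_space Z"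
    "adjoint_preserving W X L" "adjoint_preserving X Y M" "adjoint_preserving Y Z N"
  note LM = adjoint_preserving_star[OF *(1-3,5,6)] and MN = adjoint_preserving_star[OF *(2-4,6,7)]
  note l = adjoint_preserving_star[OF *(1,3,4) LM(1) *(7)]
    and r = adjoint_preserving_star[OF *(1,2,4,5) MN(1)]
  show "star W Z N (star W Y M L) = star W Z (star X Z N M) L"
    using l(1) r(1)
    by (rule adjoint_preserving_eqI) (simp add: l(2) r(2) LM(2) MN(2) adjoint_preserving_box[OF *(7)])
qed


section \<open>The RelS-space of irreducible filters of an SLata\<close>

text \<open>Alexander's subbase theorem applies to \<open>U\<close> with the traces of members of
  \<B> as subbase. The inclusion into the generated topology is continuous, and continuous images of
  compact sets are compact.\<close>

lemma compactin_topology_generated_by: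
  assumes U: "U \<subseteq> \<Union>\<B>"
    and fin: "\<And>\<C>. \<C> \<subseteq> \<B> \<Longrightarrow> U \<subseteq> \<Union>\<C> \<Longrightarrow> \<exists>\<C>'. finite \<C>' \<and> \<C>' \<subseteq> \<C> \<and> U \<subseteq> \<Union>\<C>'"
  shows "compactin (topology_generated_by \<B>) U"
proof -
  let ?X = "topology (arbitrary union_of (finite intersection_of (\<lambda>V. V \<in> \<B>) relative_to U))"
  have X: "topspace ?X = U" by (rule topspace_subbase)
  have "compact_space ?X" by (rule Alexander_subbase_alt[OF U fin refl])
  then have "compactin ?X U" unfolding compact_space_def X .
  moreover have "continuous_map ?X (topology_generated_by \<B>) (\<lambda>x. x)"
  proof (rule continuous_on_generated_topo)
    fix V assume "V \<in> \<B>"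
    then have "(arbitrary union_of (finite intersection_of (\<lambda>V. V \<in> \<B>) relative_to U)) (U \<inter> V)"
      by (intro arbitrary_union_of_inc relative_to_inc finite_intersection_of_inc)
    then show "openin ?X ((\<lambda>x. x) -` V \<inter> topspace ?X)"
      unfolding openin_subbase X by (simp add: Int_commute)
  qed (use U X in simp)
  ultimately show ?thesis by (metis image_compactin image_ident)
qed

section \<open>Filters of a semilattice\<close>

definition sl_filter :: "('a, 'z) semilat_scheme \<Rightarrow> 'a set \<Rightarrow> bool" where
  "sl_filter A F \<longleftrightarrow> F \<subseteq> elems A \<and> top_el A \<in> F \<and> (\<forall>a\<in>F. \<forall>b\<in>F. meet A a b \<in> F) \<and>
     (\<forall>a\<in>F. \<forall>b\<in>elems A. sl_le A a b \<longrightarrow> b \<in> F)"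

text \<open>
  A proper filter \<open>P\<close> with this property is exactly a meet-irreducible element of the filter
  lattice: if \<open>a\<close> and \<open>b\<close> are outside \<open>P\<close>, then the filters generated by \<open>P\<close> with \<open>a\<close>, and by
  \<open>P\<close> with \<open>b\<close>, have a common element \<open>c\<close> outside \<open>P\<close>.
\<close>

definition irreducible_filter :: "('a, 'z) semilat_scheme \<Rightarrow> 'a set \<Rightarrow> bool" where
  "irreducible_filter A P \<longleftrightarrow> sl_filter A P \<and> P \<noteq> elems A \<and>
     (\<forall>a\<in>elems A - P. \<forall>b\<in>elems A - P. \<exists>c\<in>elems A - P. \<exists>f\<in>P.
        sl_le A (meet A a f) c \<and> sl_le A (meet A b f) c)"

lemma sl_filterD:
  assumes "sl_filter A F"
  shows "F \<subseteq> elems A" "top_el A \<in> F" "\<And>a b. a \<in> F \<Longrightarrow> b \<in> F \<Longrightarrow> meet A a b \<in> F"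
    "\<And>a b. a \<in> F \<Longrightarrow> b \<in> elems A \<Longrightarrow> sl_le A a b \<Longrightarrow> b \<in> F"
  using assms unfolding sl_filter_def by blast+

lemma irreducible_filterD:
  assumes "irreducible_filter A P"
  shows "sl_filter A P" "\<exists>a\<in>elems A. a \<notin> P"
    "\<And>a b. a \<in> elems A \<Longrightarrow> b \<in> elems A \<Longrightarrow> a \<notin> P \<Longrightarrow> b \<notin> P \<Longrightarrow>
      \<exists>c\<in>elems A. \<exists>f\<in>P. c \<notin> P \<and> sl_le A (meet A a f) c \<and> sl_le A (meet A b f) c"
proof -
  show F: "sl_filter A P" using assms unfolding irreducible_filter_def by blast
  show "\<exists>a\<in>elems A. a \<notin> P"
    using assms sl_filterD(1)[OF F] unfolding irreducible_filter_def by blast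
  show "\<exists>c\<in>elems A. \<exists>f\<in>P. c \<notin> P \<and> sl_le A (meet A a f) c \<and> sl_le A (meet A b f) c"
    if "a \<in> elems A" "b \<in> elems A" "a \<notin> P" "b \<notin> P" for a b
  proof -
    have "\<exists>c\<in>elems A - P. \<exists>f\<in>P. sl_le A (meet A a f) c \<and> sl_le A (meet A b f) c"
      using assms that unfolding irreducible_filter_def by (elim conjE) blast
    then show ?thesis by blast
  qed
qed

text \<open>This is the filter generated by \<open>F\<close> and \<open>a\<close>; it is used to
  test the maximality of a filter against one outside element.\<close>

lemma sl_filter_generated:
  assumes A: "is_semilattice A" and F: "sl_filter A F" and a: "a \<in> elems A"
  shows "sl_filter A {x \<in> elems A. \<exists>p\<in>F. sl_le A (meet A p a) x}" (is "sl_filter A ?E")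
  unfolding sl_filter_def
proof (intro conjI ballI impI)
  note FD = sl_filterD[OF F]
  have pa: "meet A p a \<in> elems A" if "p \<in> F" for p using that FD(1) a meet_in[OF A] by blast
  show "top_el A \<in> ?E"
    using FD(2) sl_le_top[OF A pa] top_in[OF A] by blast
  show "meet A x y \<in> ?E" if xy: "x \<in> ?E" "y \<in> ?E" for x y
  proof -
    obtain p q where p: "p \<in> F" "sl_le A (meet A p a) x" and q: "q \<in> F" "sl_le A (meet A q a) y"
      using xy by blast
    have in_A: "x \<in> elems A" "y \<in> elems A" "p \<in> elems A" "q \<in> elems A"
      using xy p q FD(1) by blast+
    have pq: "meet A p q \<in> F" "meet A p q \<in> elems A" using FD(3) p q in_A meet_in[OF A] by blast+
    have "sl_le A (meet A (meet A p q) a) (meet A r a)"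
      if "sl_le A (meet A p q) r" "r \<in> elems A" for r
      using that a pq meet_in[OF A]
      by (intro le_meetI[OF A] sl_le_trans[OF A _ _ _ meet_le1[OF A] that(1)] meet_le2[OF A]) auto
    then have "sl_le A (meet A (meet A p q) a) (meet A p a)" "sl_le A (meet A (meet A p q) a) (meet A q a)"
      using in_A meet_le1[OF A] meet_le2[OF A] by blast+
    then have "sl_le A (meet A (meet A p q) a) (meet A x y)"
      using in_A p q pa[OF pq(1)] pa
      by (intro le_meetI[OF A]) (auto intro: sl_le_trans[OF A])
    then show ?thesis using pq(1) in_A meet_in[OF A] by blast
  qed
  show "y \<in> ?E" if x: "x \<in> ?E" and y: "y \<in> elems A" "sl_le A x y" for x y
  proof -
    obtain p where "p \<in> F" "sl_le A (meet A p a) x" using x by blast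
    then show ?thesis using x y sl_le_trans[OF A pa, of p x y] by blast
  qed
qed auto

text \<open>With \<open>J = {b}\<close> this separates points; with a general \<open>J\<close> it is (S4) for the dual space.\<close>

lemma exists_irreducible_filter:
  assumes A: "is_semilattice A" and F: "sl_filter A F"
    and J: "J \<subseteq> elems A" "J \<noteq> {}" "F \<inter> J = {}"
    and dir: "\<And>a b. a \<in> J \<Longrightarrow> b \<in> J \<Longrightarrow>
      \<exists>h\<in>F. \<exists>c\<in>J. sl_le A (meet A a h) c \<and> sl_le A (meet A b h) c"
  shows "\<exists>P. irreducible_filter A P \<and> F \<subseteq> P \<and> P \<inter> J = {}"
proof -
  let ?\<A> = "{G. sl_filter A G \<and> F \<subseteq> G \<and> G \<inter> J = {}}"
  have "\<exists>M\<in>?\<A>. \<forall>X\<in>?\<A>. M \<subseteq> X \<longrightarrow> X = M"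
  proof (rule subset_Zorn_nonempty)
    show "?\<A> \<noteq> {}" using F J by blast
    fix \<C> assume C: "\<C> \<noteq> {}" "subset.chain ?\<A> \<C>"
    then have D: "sl_filter A G" "F \<subseteq> G" "G \<inter> J = {}" if "G \<in> \<C>" for G
      using that by (auto simp: subset_chain_def)
    have "meet A a b \<in> \<Union>\<C>" if ab: "a \<in> \<Union>\<C>" "b \<in> \<Union>\<C>" for a b
    proof -
      obtain G H where GH: "G \<in> \<C>" "a \<in> G" "H \<in> \<C>" "b \<in> H" using ab by blast
      then have "G \<subseteq> H \<or> H \<subseteq> G" using C(2) unfolding subset_chain_def by blast
      then have "\<exists>K\<in>\<C>. a \<in> K \<and> b \<in> K" using GH by blast
      then show ?thesis using sl_filterD(3)[OF D(1)] by blast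
    qed
    moreover have "b \<in> \<Union>\<C>" if "a \<in> \<Union>\<C>" "b \<in> elems A" "sl_le A a b" for a b
      using that sl_filterD(4)[OF D(1)] by blast
    moreover have "top_el A \<in> \<Union>\<C>" using C(1) sl_filterD(2)[OF D(1)] by blast
    moreover have "\<Union>\<C> \<subseteq> elems A" using sl_filterD(1)[OF D(1)] by blast
    ultimately have "sl_filter A (\<Union>\<C>)" unfolding sl_filter_def by blast
    then show "\<Union>\<C> \<in> ?\<A>" using C(1) D(2,3) by blast
  qed
  then obtain M where M_in: "M \<in> ?\<A>" and M_max: "\<forall>X\<in>?\<A>. M \<subseteq> X \<longrightarrow> X = M" by (rule bexE)
  have M: "sl_filter A M" "F \<subseteq> M" "M \<inter> J = {}" using M_in by simp_all
  have max: "X = M" if "sl_filter A X" "F \<subseteq> X" "X \<inter> J = {}" "M \<subseteq> X" for X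
    using M_max that by simp
  note MD = sl_filterD[OF M(1)]
  \<comment> \<open>The filter generated by \<open>M\<close> and \<open>a\<close> is strictly larger
    than \<open>M\<close>, so by maximality it meets \<open>J\<close>.\<close>
  have reach: "\<exists>p\<in>M. \<exists>j\<in>J. sl_le A (meet A p a) j" if a: "a \<in> elems A" "a \<notin> M" for a
  proof (rule ccontr)
    assume no: "\<not> (\<exists>p\<in>M. \<exists>j\<in>J. sl_le A (meet A p a) j)"
    let ?E = "{x \<in> elems A. \<exists>p\<in>M. sl_le A (meet A p a) x}"
    have "M \<subseteq> ?E" using MD(1) meet_le1[OF A _ a(1)] by blast
    moreover have "a \<in> ?E" using MD(1,2) meet_le2[OF A _ a(1)] a(1) by blast
    moreover have "?E \<inter> J = {}" using no by blast
    moreover have "?E = M"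
      using calculation M(2) by (intro max[OF sl_filter_generated[OF A M(1) a(1)]]) auto
    ultimately show False using a(2) by blast
  qed
  have "\<exists>c\<in>elems A - M. \<exists>f\<in>M. sl_le A (meet A a f) c \<and> sl_le A (meet A b f) c"
    if ab: "a \<in> elems A - M" "b \<in> elems A - M" for a b
  proof -
    obtain p i where p: "p \<in> M" "i \<in> J" "sl_le A (meet A p a) i" using reach ab by blast
    obtain q j where q: "q \<in> M" "j \<in> J" "sl_le A (meet A q b) j" using reach ab by blast
    obtain h c where h: "h \<in> F" "c \<in> J" "sl_le A (meet A i h) c" "sl_le A (meet A j h) c"
      using dir[OF p(2) q(2)] by blast
    \<comment> \<open>One element of \<open>M\<close> serves both sides: \<open>p\<close> and
      \<open>q\<close> bring \<open>a\<close> and \<open>b\<close> below members \<open>i\<close>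
      and \<open>j\<close> of \<open>J\<close>, and \<open>h\<close> brings these below the common
      \<open>c\<close>, which is outside \<open>M\<close> because it lies in
      \<open>J\<close>.\<close>
    let ?f = "meet A (meet A p q) h"
    have in_A: "a \<in> elems A" "b \<in> elems A" "p \<in> elems A" "q \<in> elems A" "h \<in> elems A"
      "i \<in> elems A" "j \<in> elems A" "c \<in> elems A"
      using ab p q h MD(1) M(2) J(1) by blast+
    have f: "?f \<in> M" "?f \<in> elems A" using p q h M(2) MD(1,3) by blast+
    have pq: "meet A p q \<in> elems A" using in_A meet_in[OF A] by blast
    have le: "sl_le A ?f p" "sl_le A ?f q" "sl_le A ?f h"
      using sl_le_trans[OF A f(2) pq] meet_le1[OF A pq in_A(5)] meet_le2[OF A pq in_A(5)]
        meet_le1[OF A in_A(3,4)] meet_le2[OF A in_A(3,4)] in_A by blast+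
    have key: "sl_le A (meet A x ?f) c"
      if x: "x \<in> elems A" "r \<in> elems A" "k \<in> elems A" "sl_le A ?f r"
        "sl_le A (meet A r x) k" "sl_le A (meet A k h) c" for x r k
    proof -
      note m = meet_in[OF A]
      have xf: "meet A x ?f \<in> elems A" "sl_le A (meet A x ?f) x" "sl_le A (meet A x ?f) ?f"
        using x f(2) m meet_le1[OF A] meet_le2[OF A] by blast+
      have "sl_le A (meet A x ?f) r" using sl_le_trans[OF A xf(1) f(2) x(2) xf(3) x(4)] .
      then have "sl_le A (meet A x ?f) (meet A r x)" using le_meetI[OF A x(2,1) xf(1)] xf(2) by blast
      then have "sl_le A (meet A x ?f) k"
        using sl_le_trans[OF A xf(1) m[OF x(2,1)] x(3)] x(5) by blast
      moreover have "sl_le A (meet A x ?f) h" using sl_le_trans[OF A xf(1) f(2) in_A(5) xf(3) le(3)] .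
      ultimately have "sl_le A (meet A x ?f) (meet A k h)"
        using le_meetI[OF A x(3) in_A(5) xf(1)] by blast
      then show ?thesis using sl_le_trans[OF A xf(1) m[OF x(3) in_A(5)] in_A(8)] x(6) by blast
    qed
    have "sl_le A (meet A a ?f) c" "sl_le A (meet A b ?f) c"
      using key[OF in_A(1,3,6) le(1) p(3) h(3)] key[OF in_A(2,4,7) le(2) q(3) h(4)] .
    moreover have "c \<in> elems A - M" using h(2) in_A(8) M(3) by blast
    ultimately show ?thesis using f(1) by blast
  qed
  moreover have "M \<noteq> elems A" using J(1,2) M(3) by blast
  ultimately have "irreducible_filter A M" unfolding irreducible_filter_def using M(1) by blast
  then show ?thesis using M by blast
qed

text \<open>The representation map, in the style of Stone. Its values are closed: they are the
  complements of the subbasic open sets of \<open>dual_space A\<close>.\<close>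

definition beta :: "('a, 'z) semilat_scheme \<Rightarrow> 'a \<Rightarrow> 'a set set" where
  "beta A a = {P. irreducible_filter A P \<and> a \<in> P}"

text \<open>As for canonical relations in modal logic, \<open>P\<close> is related to
  \<open>Q\<close> when the preimage of \<open>P\<close> under \<open>d_op A\<close> lies in
  \<open>Q\<close>. The operation \<open>i_op A\<close> is recovered as the left adjoint.\<close>

definition dual_space :: "'a slata \<Rightarrow> 'a set rels_space" where
  "dual_space A = \<lparr>points = {P. irreducible_filter A P},
     subbase = (\<lambda>a. {P. irreducible_filter A P} - beta A a) ` elems A,
     arel = {(P, Q). irreducible_filter A P \<and> irreducible_filter A Q \<and>
       (\<forall>a\<in>elems A. d_op A a \<in> P \<longrightarrow> a \<in> Q)}\<rparr>"

lemma dual_space_simps [simp]: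
  "points (dual_space A) = {P. irreducible_filter A P}"
  "subbase (dual_space A) = (\<lambda>a. {P. irreducible_filter A P} - beta A a) ` elems A"
  "arel (dual_space A) = {(P, Q). irreducible_filter A P \<and> irreducible_filter A Q \<and>
     (\<forall>a\<in>elems A. d_op A a \<in> P \<longrightarrow> a \<in> Q)}"
  by (simp_all add: dual_space_def)

lemma S_sets_dual_space: "S_sets (dual_space A) = beta A ` elems A"
proof -
  have "{P. irreducible_filter A P} - ({P. irreducible_filter A P} - beta A a) = beta A a" for a
    by (auto simp: beta_def)
  then show ?thesis unfolding S_sets_def dual_space_simps by auto
qed

section \<open>The representation map and compactness\<close>

context
  fixes A :: "('a, 'z) semilat_scheme"
  assumes A: "is_semilattice A"
begin

lemma separating_irreducible_filter:
  assumes "sl_filter A F" "b \<in> elems A" "b \<notin> F"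
  shows "\<exists>P. irreducible_filter A P \<and> F \<subseteq> P \<and> b \<notin> P"
proof -
  have "\<exists>P. irreducible_filter A P \<and> F \<subseteq> P \<and> P \<inter> {b} = {}"
    using assms sl_filterD(2)[OF assms(1)] meet_le1[OF A assms(2) top_in[OF A]]
    by (intro exists_irreducible_filter[OF A]) auto
  then show ?thesis by blast
qed

lemma beta_top: "beta A (top_el A) = {P. irreducible_filter A P}"
  unfolding beta_def using sl_filterD(2)[OF irreducible_filterD(1)] by blast

text \<open>If \<open>a\<close> is not below \<open>b\<close>, some irreducible filter extends the
  principal filter of \<open>a\<close> and omits \<open>b\<close>.\<close>

lemma beta_subset_iff:
  assumes a: "a \<in> elems A" and b: "b \<in> elems A"
  shows "beta A a \<subseteq> beta A b \<longleftrightarrow> sl_le A a b"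
proof
  assume "sl_le A a b"
  then show "beta A a \<subseteq> beta A b"
    unfolding beta_def using sl_filterD(4)[OF irreducible_filterD(1) _ b] by blast
next
  assume sub: "beta A a \<subseteq> beta A b"
  let ?F = "{x \<in> elems A. sl_le A a x}"
  have "sl_filter A ?F"
    unfolding sl_filter_def
  proof (intro conjI ballI impI)
    show "top_el A \<in> ?F" using a top_in[OF A] sl_le_top[OF A] by blast
    show "meet A x y \<in> ?F" if "x \<in> ?F" "y \<in> ?F" for x y
      using that a le_meetI[OF A] meet_in[OF A] by blast
    show "y \<in> ?F" if "x \<in> ?F" "y \<in> elems A" "sl_le A x y" for x y
      using that a sl_le_trans[OF A, of a x y] by blast
  qed blast
  moreover have "a \<in> ?F" using a sl_le_refl[OF A] by blast
  ultimately show "sl_le A a b"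
    using separating_irreducible_filter[of ?F b] sub b unfolding beta_def by blast
qed

lemma beta_meet:
  assumes "a \<in> elems A" "b \<in> elems A"
  shows "beta A (meet A a b) = beta A a \<inter> beta A b"
proof
  show "beta A (meet A a b) \<subseteq> beta A a \<inter> beta A b"
    using meet_le1[OF A assms] meet_le2[OF A assms]
    by (simp add: beta_subset_iff meet_in[OF A] assms)
  show "beta A a \<inter> beta A b \<subseteq> beta A (meet A a b)"
    by (auto simp: beta_def intro: sl_filterD(3)[OF irreducible_filterD(1)])
qed

lemma inj_on_beta: "inj_on (beta A) (elems A)"
  by (rule inj_onI) (metis beta_subset_iff sl_le_antisym[OF A] order_refl)

text \<open>Only subbasic covers matter. The \<open>x\<close> for which the complement of
  \<open>beta A x\<close> has a finite subcover form a filter. Were \<open>a\<close> outside it, an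
  irreducible \<open>P\<close> would extend it and omit \<open>a\<close>. The member of the cover
  around \<open>P\<close> would be the complement of some \<open>beta A b\<close>, with
  \<open>b\<close> in the filter but not in \<open>P\<close>.\<close>

lemma compactin_compl_beta:
  assumes a: "a \<in> elems A"
  shows "compactin (topology_generated_by ((\<lambda>a. {P. irreducible_filter A P} - beta A a) ` elems A))
           ({P. irreducible_filter A P} - beta A a)"
    (is "compactin (topology_generated_by ?K) (?X - _)")
proof (rule compactin_topology_generated_by)
  show "?X - beta A a \<subseteq> \<Union>?K" using a by blast
  fix \<C> assume C: "\<C> \<subseteq> ?K" "?X - beta A a \<subseteq> \<Union>\<C>"
  define fin where "fin x \<longleftrightarrow> (\<exists>\<C>'. finite \<C>' \<and> \<C>' \<subseteq> \<C> \<and> ?X - beta A x \<subseteq> \<Union>\<C>')" for x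
  have finI: "fin x" if "finite \<C>'" "\<C>' \<subseteq> \<C>" "?X - beta A x \<subseteq> \<Union>\<C>'" for x \<C>'
    unfolding fin_def using that by (intro exI[of _ \<C>'] conjI)
  let ?F = "{x \<in> elems A. fin x}"
  have F: "sl_filter A ?F"
    unfolding sl_filter_def
  proof (intro conjI ballI impI)
    have "fin (top_el A)" by (rule finI[of "{}"]) (simp_all add: beta_top)
    then show "top_el A \<in> ?F" using top_in[OF A] by simp
    show "meet A x y \<in> ?F" if xy: "x \<in> ?F" "y \<in> ?F" for x y
    proof -
      have in_A: "x \<in> elems A" "y \<in> elems A" using xy by simp_all
      obtain \<D> where D: "finite \<D>" "\<D> \<subseteq> \<C>" "?X - beta A x \<subseteq> \<Union>\<D>"
        using xy(1) unfolding fin_def by auto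
      obtain \<E> where E: "finite \<E>" "\<E> \<subseteq> \<C>" "?X - beta A y \<subseteq> \<Union>\<E>"
        using xy(2) unfolding fin_def by auto
      have "?X - beta A (meet A x y) \<subseteq> \<Union>(\<D> \<union> \<E>)"
        unfolding beta_meet[OF in_A] Diff_Int Union_Un_distrib by (rule Un_mono[OF D(3) E(3)])
      then have "fin (meet A x y)" using D E by (intro finI[of "\<D> \<union> \<E>"]) auto
      then show ?thesis using meet_in[OF A in_A] by simp
    qed
    show "y \<in> ?F" if x: "x \<in> ?F" and y: "y \<in> elems A" "sl_le A x y" for x y
    proof -
      obtain \<D> where D: "finite \<D>" "\<D> \<subseteq> \<C>" "?X - beta A x \<subseteq> \<Union>\<D>"
        using x unfolding fin_def by auto
      have "beta A x \<subseteq> beta A y" using x y by (simp add: beta_subset_iff)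
      then have "?X - beta A y \<subseteq> \<Union>\<D>" using D(3) by blast
      then have "fin y" by (rule finI[OF D(1,2)])
      then show ?thesis using y by simp
    qed
  qed blast
  have "a \<in> ?F"
  proof (rule ccontr)
    assume "a \<notin> ?F"
    then obtain P where P: "irreducible_filter A P" "?F \<subseteq> P" "a \<notin> P"
      using separating_irreducible_filter[OF F a] by blast
    then have "P \<in> ?X - beta A a" by (simp add: beta_def)
    then obtain U where U: "U \<in> \<C>" "P \<in> U" using C(2) by (meson UnionE subsetD)
    from subsetD[OF C(1) U(1)] obtain b where "U = ?X - beta A b" "b \<in> elems A" by (rule imageE)
    with U have b: "b \<in> elems A" "?X - beta A b \<in> \<C>" "P \<in> ?X - beta A b" by simp_all
    have "fin b" using b(2) by (intro finI[of "{?X - beta A b}"]) simp_all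
    then have "b \<in> ?F" using b(1) by simp
    then show False using P b(3) by (auto simp: beta_def)
  qed
  then show "\<exists>\<C>'. finite \<C>' \<and> \<C>' \<subseteq> \<C> \<and> ?X - beta A a \<subseteq> \<Union>\<C>'" by (simp add: fin_def)
qed

end

text \<open>Let \<open>?F\<close> collect the elements whose \<open>beta\<close> contains
  \<open>Y\<close>, and \<open>?J\<close> those whose \<open>beta\<close> is in the family. That
  \<open>Y\<close> meets all complements makes the two disjoint, and the family condition makes
  \<open>?J\<close> directed modulo \<open>?F\<close>. An irreducible filter that contains
  \<open>?F\<close> and avoids \<open>?J\<close> is the required point.\<close>

lemma S4_dual_space:
  fixes A :: "'a slata"
  assumes A: "is_semilattice A" and Y: "Y \<in> C_sets (dual_space A)"
    and J: "Y_family (dual_space A) Y \<J>" "\<forall>B\<in>\<J>. Y \<inter> (points (dual_space A) - B) \<noteq> {}"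
  shows "Y \<inter> \<Inter>{points (dual_space A) - B | B. B \<in> \<J>} \<noteq> {}"
proof -
  let ?X = "{P. irreducible_filter A P}"
  obtain \<A> where \<A>: "Y = ?X \<inter> \<Inter>\<A>" "\<A> \<subseteq> beta A ` elems A"
    using Y by (auto simp: C_sets_def S_sets_dual_space)
  have J': "\<J> \<subseteq> beta A ` elems A" "\<J> \<noteq> {}"
    and J_dir: "\<And>B C. B \<in> \<J> \<Longrightarrow> C \<in> \<J> \<Longrightarrow>
      \<exists>H\<in>beta A ` elems A. \<exists>D\<in>\<J>. Y \<subseteq> H \<and> B \<inter> H \<subseteq> D \<and> C \<inter> H \<subseteq> D"
    using J(1) by (simp_all add: Y_family_def S_sets_dual_space del: bex_simps)
  let ?F = "{x \<in> elems A. Y \<subseteq> beta A x}"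
  let ?J = "{x \<in> elems A. beta A x \<in> \<J>}"
  have F: "sl_filter A ?F"
    unfolding sl_filter_def
  proof (intro conjI ballI impI)
    show "top_el A \<in> ?F" using top_in[OF A] beta_top[OF A] \<A>(1) by blast
    show "meet A x y \<in> ?F" if "x \<in> ?F" "y \<in> ?F" for x y
      using that beta_meet[OF A, of x y] meet_in[OF A, of x y] by blast
    show "y \<in> ?F" if "x \<in> ?F" "y \<in> elems A" "sl_le A x y" for x y
      using that beta_subset_iff[OF A, of x y] by blast
  qed blast
  have "\<exists>P. irreducible_filter A P \<and> ?F \<subseteq> P \<and> P \<inter> ?J = {}"
  proof (rule exists_irreducible_filter[OF A F])
    show "?J \<noteq> {}" using J' by blast
    show "?F \<inter> ?J = {}" using J(2) by auto
    show "\<exists>h\<in>?F. \<exists>c\<in>?J. sl_le A (meet A a h) c \<and> sl_le A (meet A b h) c"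
      if ab: "a \<in> ?J" "b \<in> ?J" for a b
    proof -
      have "beta A a \<in> \<J>" "beta A b \<in> \<J>" using ab by blast+
      from J_dir[OF this] J'(1) obtain h c where h: "h \<in> elems A" "c \<in> elems A" "beta A c \<in> \<J>"
        "Y \<subseteq> beta A h" "beta A a \<inter> beta A h \<subseteq> beta A c" "beta A b \<inter> beta A h \<subseteq> beta A c"
        by blast
      have in_A: "a \<in> elems A" "b \<in> elems A" using ab by blast+
      have "sl_le A (meet A a h) c" "sl_le A (meet A b h) c"
        using h(5,6)
        unfolding beta_meet[OF A in_A(1) h(1), symmetric] beta_meet[OF A in_A(2) h(1), symmetric]
          beta_subset_iff[OF A meet_in[OF A in_A(1) h(1)] h(2)]
          beta_subset_iff[OF A meet_in[OF A in_A(2) h(1)] h(2)] .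
      then show ?thesis using h by blast
    qed
  qed blast
  then obtain P where P: "irreducible_filter A P" "?F \<subseteq> P" "P \<inter> ?J = {}" by blast
  \<comment> \<open>\<open>Y\<close> is an intersection of sets \<open>beta A a\<close>, and every
    such \<open>a\<close> lies in \<open>?F\<close>.\<close>
  have "P \<in> Y"
  proof -
    have "P \<in> B" if B: "B \<in> \<A>" for B
    proof -
      obtain a where a: "a \<in> elems A" "B = beta A a" using \<A>(2) B by blast
      then have "a \<in> ?F" using \<A>(1) B by blast
      then show ?thesis using P a by (auto simp: beta_def)
    qed
    then show ?thesis using P(1) \<A>(1) by blast
  qed
  moreover have "P \<in> ?X - B" if B: "B \<in> \<J>" for B
  proof -
    obtain a where "a \<in> elems A" "B = beta A a" using J'(1) B by blast
    then show ?thesis using P(1,3) B by (auto simp: beta_def)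
  qed
  ultimately show ?thesis unfolding dual_space_simps by blast
qed

text \<open>T0 holds since distinct filters differ in an element; unions in the subbase come from
  meets in \<open>A\<close>; (S3) is irreducibility.\<close>

lemma is_sspace_dual_space:
  fixes A :: "'a slata"
  assumes A: "is_semilattice A"
  shows "is_sspace (dual_space A)"
proof -
  let ?X = "{P. irreducible_filter A P}"
  let ?K = "(\<lambda>a. ?X - beta A a) ` elems A"
  have union: "?X = \<Union>?K"
  proof
    \<comment> \<open>An irreducible filter is proper, so it lies in the complement of
      \<open>beta A a\<close> for some omitted \<open>a\<close>.\<close>
    show "?X \<subseteq> \<Union>?K" using irreducible_filterD(2) by (fastforce simp: beta_def)
  qed blast
  have t0: "t0_space (topology_generated_by ?K)"
    unfolding t0_space_def topology_generated_by_topspace union[symmetric]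
  proof (intro ballI impI)
    fix P Q assume PQ: "P \<in> ?X" "Q \<in> ?X" "P \<noteq> Q"
    have "P \<subseteq> elems A" "Q \<subseteq> elems A"
      using PQ sl_filterD(1)[OF irreducible_filterD(1)] by blast+
    then obtain a where a: "a \<in> elems A" "a \<in> P \<longleftrightarrow> a \<notin> Q" using PQ(3) by blast
    have "openin (topology_generated_by ?K) (?X - beta A a)"
      using a(1) by (intro topology_generated_by_Basis) blast
    then show "\<exists>U. openin (topology_generated_by ?K) U \<and> (P \<notin> U \<longleftrightarrow> Q \<in> U)"
      using PQ a(2) by (intro exI[of _ "?X - beta A a"]) (auto simp: beta_def)
  qed
  have cpt: "openin (topology_generated_by ?K) U \<and> compactin (topology_generated_by ?K) U"
    if U: "U \<in> ?K" for U
  proof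
    show "openin (topology_generated_by ?K) U" using U by (rule topology_generated_by_Basis)
    show "compactin (topology_generated_by ?K) U" using U compactin_compl_beta[OF A] by blast
  qed
  have un: "U \<union> V \<in> ?K" if UV: "U \<in> ?K" "V \<in> ?K" for U V
  proof -
    obtain a b where ab: "a \<in> elems A" "b \<in> elems A" "U = ?X - beta A a" "V = ?X - beta A b"
      using UV by blast
    then have "U \<union> V = ?X - beta A (meet A a b)" by (simp add: beta_meet[OF A] Diff_Int)
    then show ?thesis using meet_in[OF A ab(1,2)] by blast
  qed
  have empty: "{} \<in> ?K"
    using top_in[OF A] beta_top[OF A] by (intro image_eqI[of _ _ "top_el A"]) simp_all
  have s3: "\<exists>W\<in>?K. \<exists>D\<in>?K. P \<notin> W \<and> P \<in> D \<and> D \<subseteq> (U \<inter> V) \<union> W"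
    if UV: "U \<in> ?K" "V \<in> ?K" "P \<in> U \<inter> V" for U V P
  proof -
    obtain a b where ab: "a \<in> elems A" "b \<in> elems A" "U = ?X - beta A a" "V = ?X - beta A b"
      using UV by blast
    have P: "irreducible_filter A P" "a \<notin> P" "b \<notin> P"
      using UV(3) ab by (auto simp: beta_def)
    \<comment> \<open>The complements of \<open>beta A f\<close> and \<open>beta A c\<close> become
      \<open>W\<close> and \<open>D\<close>: the point \<open>P\<close> avoids the first because
      \<open>f\<close> is in \<open>P\<close>, and lies in the second because \<open>c\<close> is
      not.\<close>
    obtain c f where c: "c \<in> elems A" "f \<in> P" "c \<notin> P" "sl_le A (meet A a f) c" "sl_le A (meet A b f) c"
      using irreducible_filterD(3)[OF P(1) ab(1,2) P(2,3)] by blast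
    have f: "f \<in> elems A" using c(2) sl_filterD(1)[OF irreducible_filterD(1)[OF P(1)]] by blast
    have "beta A a \<inter> beta A f \<subseteq> beta A c" "beta A b \<inter> beta A f \<subseteq> beta A c"
      using c(4,5) ab(1,2) f c(1) by (simp_all add: beta_meet[OF A, symmetric] beta_subset_iff[OF A] meet_in[OF A])
    then have "?X - beta A c \<subseteq> (U \<inter> V) \<union> (?X - beta A f)" unfolding ab(3,4) by blast
    moreover have "P \<notin> ?X - beta A f" "P \<in> ?X - beta A c" using P(1) c(2,3) by (auto simp: beta_def)
    moreover have "?X - beta A f \<in> ?K" "?X - beta A c \<in> ?K" using f c(1) by blast+
    ultimately show ?thesis by (intro bexI[of _ "?X - beta A f"] bexI[of _ "?X - beta A c"] conjI)
  qed
  show ?thesis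
    unfolding is_sspace_def
  proof (intro conjI)
    show "\<forall>Y\<in>C_sets (dual_space A). \<forall>\<J>. Y_family (dual_space A) Y \<J> \<and>
        (\<forall>B\<in>\<J>. Y \<inter> (points (dual_space A) - B) \<noteq> {}) \<longrightarrow>
        Y \<inter> \<Inter>{points (dual_space A) - B | B. B \<in> \<J>} \<noteq> {}"
      by (intro ballI allI impI) (elim conjE, rule S4_dual_space[OF A])
    show "\<forall>U\<in>subbase (dual_space A). \<forall>V\<in>subbase (dual_space A). \<forall>P\<in>U \<inter> V.
        \<exists>W\<in>subbase (dual_space A). \<exists>D\<in>subbase (dual_space A). P \<notin> W \<and> P \<in> D \<and> D \<subseteq> (U \<inter> V) \<union> W"
      unfolding dual_space_simps by (intro ballI) (rule s3)
    show "\<forall>U\<in>subbase (dual_space A). \<forall>V\<in>subbase (dual_space A). U \<union> V \<in> subbase (dual_space A)"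
      unfolding dual_space_simps by (intro ballI) (rule un)
    show "\<forall>U\<in>subbase (dual_space A). openin (sspace_topology (dual_space A)) U \<and>
        compactin (sspace_topology (dual_space A)) U"
      unfolding dual_space_simps by (intro ballI) (rule cpt)
    show "subbase (dual_space A) \<subseteq> Pow (points (dual_space A))"
      unfolding dual_space_simps by blast
    show "points (dual_space A) = \<Union>(subbase (dual_space A))"
      unfolding dual_space_simps by (rule union)
    show "t0_space (sspace_topology (dual_space A))" unfolding dual_space_simps by (rule t0)
    show "{} \<in> subbase (dual_space A)" unfolding dual_space_simps by (rule empty)
  qed
qed

section \<open>The operations recovered from the filter space\<close>

context
  fixes A :: "'a slata"
  assumes A: "is_slata A"
begin

private lemmas SL = slata_semilattice[OF A]

text \<open>The preimage of \<open>P\<close> under \<open>d_op A\<close> is a filter. If it omits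
  \<open>a\<close>, so does some irreducible filter \<open>Q\<close> extending it; this
  \<open>Q\<close> is related to \<open>P\<close> and refutes membership of \<open>P\<close> in the
  box.\<close>

lemma box_dual_space_beta:
  assumes a: "a \<in> elems A"
  shows "box (dual_space A) (arel (dual_space A)) (beta A a) = beta A (d_op A a)"
proof (intro equalityI subsetI)
  fix P assume "P \<in> beta A (d_op A a)"
  then show "P \<in> box (dual_space A) (arel (dual_space A)) (beta A a)"
    using a by (auto simp: beta_def box_def)
next
  fix P assume P: "P \<in> box (dual_space A) (arel (dual_space A)) (beta A a)"
  then have irr: "irreducible_filter A P" by (simp add: box_def)
  note PD = sl_filterD[OF irreducible_filterD(1)[OF irr]]
  let ?F = "{x \<in> elems A. d_op A x \<in> P}"
  have F: "sl_filter A ?F"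
    unfolding sl_filter_def
  proof (intro conjI ballI impI)
    show "top_el A \<in> ?F" using PD(2) d_top[OF A] top_in[OF SL] by simp
    show "meet A x y \<in> ?F" if xy: "x \<in> ?F" "y \<in> ?F" for x y
    proof -
      have in_A: "x \<in> elems A" "y \<in> elems A" and "meet A (d_op A x) (d_op A y) \<in> P"
        using xy PD(3) by blast+
      then have "d_op A (meet A x y) \<in> P"
        using PD(4) meet_d_le[OF A in_A] d_in[OF A meet_in[OF SL in_A]] by blast
      then show ?thesis using meet_in[OF SL in_A] by blast
    qed
    show "y \<in> ?F" if "x \<in> ?F" "y \<in> elems A" "sl_le A x y" for x y
      using that PD(4)[OF _ d_in[OF A], of "d_op A x" y] d_mono[OF A, of x y] by blast
  qed blast
  have "a \<in> ?F"
  proof (rule ccontr)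
    assume "a \<notin> ?F"
    then obtain Q where Q: "irreducible_filter A Q" "?F \<subseteq> Q" "a \<notin> Q"
      using separating_irreducible_filter[OF SL F a] by blast
    then have "Q \<in> arel (dual_space A) `` {P}" using irr by auto
    then show False using P Q(3) unfolding box_def beta_def by blast
  qed
  then show "P \<in> beta A (d_op A a)" using irr by (simp add: beta_def)
qed

text \<open>By the adjunction, the sets intersected are the \<open>beta A b\<close> with
  \<open>b\<close> above \<open>i_op A a\<close>, and \<open>beta A (i_op A a)\<close> is the least
  of them.\<close>

lemma ladj_dual_space_beta:
  assumes a: "a \<in> elems A"
  shows "ladj (dual_space A) (beta A a) = beta A (i_op A a)"
proof -
  have "F_sets (dual_space A) (arel (dual_space A)) (beta A a)
      = beta A ` {b \<in> elems A. sl_le A (i_op A a) b}"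
  proof -
    have "beta A a \<subseteq> box (dual_space A) (arel (dual_space A)) (beta A b) \<longleftrightarrow> sl_le A (i_op A a) b"
      if b: "b \<in> elems A" for b
      unfolding box_dual_space_beta[OF b] beta_subset_iff[OF SL a d_in[OF A b]] i_le_iff[OF A a b] ..
    then show ?thesis unfolding F_sets_def S_sets_dual_space by blast
  qed
  moreover have "beta A (i_op A a) \<subseteq> beta A b" if "b \<in> elems A" "sl_le A (i_op A a) b" for b
    using that beta_subset_iff[OF SL i_in[OF A a]] by blast
  moreover have "sl_le A (i_op A a) (i_op A a)" using sl_le_refl[OF SL i_in[OF A a]] .
  moreover have "beta A (i_op A a) \<subseteq> points (dual_space A)" by (auto simp: beta_def)
  ultimately show ?thesis unfolding ladj_def using i_in[OF A a] by blast
qed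

lemma is_rels_space_dual_space: "is_rels_space (dual_space A)"
  unfolding is_rels_space_def is_A_relation_def
proof (intro conjI ballI is_sspace_dual_space[OF SL])
  fix U assume "U \<in> S_sets (dual_space A)"
  then obtain a where a: "a \<in> elems A" "U = beta A a" unfolding S_sets_dual_space by blast
  show "box (dual_space A) (arel (dual_space A)) U \<in> S_sets (dual_space A)"
    unfolding a(2) box_dual_space_beta[OF a(1)] S_sets_dual_space using d_in[OF A a(1)] by blast
  show "points (dual_space A) \<inter> \<Inter>(F_sets (dual_space A) (arel (dual_space A)) U) \<in> S_sets (dual_space A)"
    unfolding a(2) ladj_def[symmetric] ladj_dual_space_beta[OF a(1)] S_sets_dual_space
    using i_in[OF A a(1)] by blast
qed auto

lemma slata_iso_beta: "slata_iso A (slata_of (dual_space A)) (beta A)"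
  unfolding slata_iso_def slata_of_simps
  using inj_on_beta[OF SL]
  by (simp add: bij_betw_def S_sets_dual_space beta_meet[OF SL] beta_top[OF SL]
      box_dual_space_beta ladj_dual_space_beta del: dual_space_simps(3))

end


section \<open>The duality\<close>

text \<open>A renaming of the S-sets into the fixed type \<open>'a\<close>. Any injection will do,
  since different choices give isomorphic SLatas.\<close>

definition code :: "'x rels_space \<Rightarrow> 'x set \<Rightarrow> 'a" where
  "code X = (SOME e. inj_on e (S_sets X))"

definition coded :: "'x rels_space \<Rightarrow> 'a slata" where
  "coded X = transport (code X) (slata_of X)"

text \<open>Renaming on both sides moves the box map to the type \<open>'a\<close>; the restriction
  makes it extensional, as arrows of \<open>SLata\<close> must be.\<close>

definition box_functor :: "('x rels_space, ('x \<times> 'x) set, 'a slata, 'a \<Rightarrow> 'a) cat_functor" where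
  "box_functor = \<lparr>on_obj = coded, on_arr = (\<lambda>X Y M. \<lambda>a\<in>elems (coded Y :: 'a slata).
     code X (box X M (inv_into (S_sets Y) (code Y) a)))\<rparr>"

text \<open>Complementation maps the subbase onto the S-sets, so the size bound passes to
  them.\<close>

lemma inj_on_code:
  assumes "sized_by TYPE('a) X"
  shows "inj_on (code X :: 'x set \<Rightarrow> 'a) (S_sets X)"
proof -
  have "S_sets X = (\<lambda>U. points X - U) ` subbase X" by (auto simp: S_sets_def)
  then have "S_sets X \<lesssim> (UNIV :: 'a set)"
    using image_lepoll lepoll_trans assms unfolding sized_by_def by metis
  then have "\<exists>e :: 'x set \<Rightarrow> 'a. inj_on e (S_sets X)" by (auto simp: lepoll_def)
  then show ?thesis unfolding code_def by (rule someI_ex)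
qed

lemma slata_iso_code:
  "sized_by TYPE('a) X \<Longrightarrow> slata_iso (slata_of X) (coded X :: 'a slata) (code X)"
  unfolding coded_def by (rule slata_iso_transport) (simp add: inj_on_code)

lemma elems_coded: "elems (coded X) = code X ` S_sets X"
  by (simp add: coded_def transport_def)

lemma code_simps:
  assumes "sized_by TYPE('a) X"
  shows "\<And>U V. U \<in> S_sets X \<Longrightarrow> V \<in> S_sets X \<Longrightarrow>
      meet (coded X) (code X U) (code X V) = (code X (U \<inter> V) :: 'a)"
    "top_el (coded X) = (code X (points X) :: 'a)"
    "\<And>U. U \<in> S_sets X \<Longrightarrow> i_op (coded X) (code X U) = (code X (ladj X U) :: 'a)"
    "\<And>U. U \<in> S_sets X \<Longrightarrow> d_op (coded X) (code X U) = (code X (box X (arel X) U) :: 'a)"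
  using slata_iso_code[OF assms] by (simp_all add: slata_iso_def)

lemma on_arr_box_functor:
  assumes "sized_by TYPE('a) Y" "U \<in> S_sets Y"
  shows "on_arr box_functor X Y M (code Y U :: 'a) = code X (box X M U)"
  using assms by (simp add: box_functor_def elems_coded inj_on_code)

lemma on_arr_box_functor_eqI:
  assumes "sized_by TYPE('a) Y" and "g \<in> extensional (elems (coded Y))"
    and "\<And>U. U \<in> S_sets Y \<Longrightarrow> code X (box X M U) = g (code Y U)"
  shows "on_arr box_functor X Y M = (g :: 'a \<Rightarrow> 'a)"
proof (rule extensionalityI[of _ "elems (coded Y)"])
  show "on_arr box_functor X Y M \<in> extensional (elems (coded Y :: 'a slata))"
    by (simp add: box_functor_def)
  show "on_arr box_functor X Y M a = g a" if "a \<in> elems (coded Y)" for a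
    using that assms by (auto simp: elems_coded on_arr_box_functor)
qed (rule assms(2))

section \<open>Bijectivity of the box functor on hom-sets\<close>

context
  fixes X Y :: "'x rels_space"
  assumes X: "is_rels_space X" "sized_by TYPE('a) X" and Y: "is_rels_space Y" "sized_by TYPE('a) Y"
begin

private lemmas SX = rels_spaceD(1)[OF X(1)] and SY = rels_spaceD(1)[OF Y(1)]

lemma on_arr_box_functor_in_slata_hom:
  assumes M: "adjoint_preserving X Y M"
  shows "on_arr box_functor X Y M \<in> slata_hom (coded Y :: 'a slata) (coded X)"
proof -
  note MM = M[unfolded adjoint_preserving_iff[OF X(1) Y(1)]]
  note MD = meet_relationD[OF MM[THEN conjunct1]]
  have ext: "on_arr box_functor X Y M \<in> extensional (elems (coded Y :: 'a slata))"
    by (simp add: box_functor_def)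
  have "on_arr box_functor X Y M \<in> elems (coded Y :: 'a slata) \<rightarrow> elems (coded X)"
    using MD(2) by (auto simp: elems_coded on_arr_box_functor[OF Y(2)])
  then have "on_arr box_functor X Y M \<in> elems (coded Y :: 'a slata) \<rightarrow>\<^sub>E elems (coded X)"
    using ext by (simp add: PiE_def)
  then show ?thesis
    unfolding slata_hom_def elems_coded
    using MM MD(2)
    by (simp add: code_simps[OF X(2)] code_simps[OF Y(2)] on_arr_box_functor[OF Y(2)]
        Int_in_S_sets[OF SY] points_in_S_sets[OF SY] rels_spaceD(3,4)[OF Y(1)]
        box_Int box_points[OF MD(1)])
qed

lemma inj_on_on_arr_box_functor:
  "inj_on (on_arr box_functor X Y :: _ \<Rightarrow> 'a \<Rightarrow> 'a) {M. adjoint_preserving X Y M}"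
proof (rule inj_onI, elim CollectE)
  fix M N assume M: "adjoint_preserving X Y M" and N: "adjoint_preserving X Y N"
    and eq: "on_arr box_functor X Y M = (on_arr box_functor X Y N :: 'a \<Rightarrow> 'a)"
  show "M = N"
  proof (rule adjoint_preserving_eqI[OF M N])
    fix U assume U: "U \<in> S_sets Y"
    have "code X (box X M U) = (code X (box X N U) :: 'a)"
      using fun_cong[OF eq, of "code Y U"] by (simp add: on_arr_box_functor[OF Y(2) U])
    then show "box X M U = box X N U"
      using inj_onD[OF inj_on_code[OF X(2)]] adjoint_preserving_box[OF M U] adjoint_preserving_box[OF N U]
      by blast
  qed
qed

text \<open>Decoding \<open>h\<close> yields a map \<open>k\<close> on S-sets that preserves all
  operations. The box map of its \<open>hom_relation\<close> is \<open>k\<close>, so by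
  \<open>adjoint_preserving_iff\<close> that relation is a morphism.\<close>

lemma on_arr_box_functor_surj:
  assumes h: "h \<in> slata_hom (coded Y :: 'a slata) (coded X)"
  shows "\<exists>M. adjoint_preserving X Y M \<and> on_arr box_functor X Y M = h"
proof -
  note hD = slata_homD[OF h]
  define k where "k U = inv_into (S_sets X) (code X) (h (code Y U))" for U
  have k: "k U \<in> S_sets X" "h (code Y U) = code X (k U)" if "U \<in> S_sets Y" for U
  proof -
    have "h (code Y U) \<in> code X ` S_sets X"
      using hD(6)[of "code Y U"] that by (simp add: elems_coded)
    then show "k U \<in> S_sets X" "h (code Y U) = code X (k U)"
      unfolding k_def by (simp_all add: inv_into_into f_inv_into_f)
  qed
  have k_eqI: "k U = V" if "U \<in> S_sets Y" "V \<in> S_sets X" "h (code Y U) = code X V" for U V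
    using that by (simp add: k_def inj_on_code[OF X(2)])
  have k_Int: "k (U \<inter> V) = k U \<inter> k V" if UV: "U \<in> S_sets Y" "V \<in> S_sets Y" for U V
  proof (rule k_eqI)
    have "h (meet (coded Y) (code Y U) (code Y V)) = meet (coded X) (h (code Y U)) (h (code Y V))"
      using UV by (intro hD(2)) (simp_all add: elems_coded)
    then show "h (code Y (U \<inter> V)) = code X (k U \<inter> k V)"
      using UV by (simp add: k code_simps[OF X(2)] code_simps[OF Y(2)])
  qed (use UV k Int_in_S_sets[OF SX] Int_in_S_sets[OF SY] in auto)
  have k_points: "k (points Y) = points X"
    using hD(3) by (intro k_eqI)
      (simp_all add: points_in_S_sets SX SY code_simps[OF X(2)] code_simps[OF Y(2)])
  have k_ladj: "k (ladj Y U) = ladj X (k U)" if U: "U \<in> S_sets Y" for U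
  proof (rule k_eqI)
    have "h (i_op (coded Y) (code Y U)) = i_op (coded X) (h (code Y U))"
      using U by (intro hD(4)) (simp add: elems_coded)
    then show "h (code Y (ladj Y U)) = code X (ladj X (k U))"
      unfolding k(2)[OF U] code_simps(3)[OF X(2) k(1)[OF U]] code_simps(3)[OF Y(2) U] .
  qed (use U k rels_spaceD(4)[OF X(1)] rels_spaceD(4)[OF Y(1)] in auto)
  have k_box: "k (box Y (arel Y) U) = box X (arel X) (k U)" if U: "U \<in> S_sets Y" for U
  proof (rule k_eqI)
    have "h (d_op (coded Y) (code Y U)) = d_op (coded X) (h (code Y U))"
      using U by (intro hD(5)) (simp add: elems_coded)
    then show "h (code Y (box Y (arel Y) U)) = code X (box X (arel X) (k U))"
      unfolding k(2)[OF U] code_simps(4)[OF X(2) k(1)[OF U]] code_simps(4)[OF Y(2) U] .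
  qed (use U k rels_spaceD(3)[OF X(1)] rels_spaceD(3)[OF Y(1)] in auto)
  let ?M = "hom_relation X Y k"
  note box = box_hom_relation[OF SY k(1) k_Int k_points]
  have "adjoint_preserving X Y ?M"
    unfolding adjoint_preserving_iff[OF X(1) Y(1)]
    using meet_relation_hom_relation[OF SY k(1) k_Int k_points]
    by (simp add: box k_ladj k_box rels_spaceD(3,4)[OF Y(1)])
  moreover have "on_arr box_functor X Y ?M = h"
    using hD(1) by (intro on_arr_box_functor_eqI[OF Y(2)]) (auto simp: box k PiE_iff)
  ultimately show ?thesis by blast
qed

end

section \<open>Assembling the equivalence\<close>

abbreviation (input) sized_RelSP :: "'a itself \<Rightarrow> ('x rels_space, ('x \<times> 'x) set) category" where
  "sized_RelSP ty \<equiv> full_subcategory RelSP (sized_by ty)"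

lemma sized_RelSP_simps:
  "Obj (sized_RelSP ty) = {X. is_rels_space X \<and> sized_by ty X}"
  "Hom (sized_RelSP ty) = (\<lambda>X Y. {M. adjoint_preserving X Y M})"
  "Ident (sized_RelSP ty) = dual_spec"
  "Comp (sized_RelSP ty) = (\<lambda>X Y Z N M. star X Z N M)"
  by (simp_all add: full_subcategory_def RelSP_def)

lemma opposite_SLata_simps:
  "Obj (opposite SLata) = {A. is_slata A}"
  "Hom (opposite SLata) = (\<lambda>A B. slata_hom B A)"
  "Ident (opposite SLata) = (\<lambda>A. restrict (\<lambda>a. a) (elems A))"
  "Comp (opposite SLata) = (\<lambda>A B C g f. compose (elems C) f g)"
  by (simp_all add: opposite_def SLata_def)

lemma is_functor_box_functor:
  "is_functor (sized_RelSP TYPE('a) :: ('x rels_space, ('x \<times> 'x) set) category)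
     (opposite (SLata :: ('a slata, 'a \<Rightarrow> 'a) category)) box_functor"
proof -
  have obj: "on_obj box_functor X = coded X" for X :: "'x rels_space"
    by (simp add: box_functor_def)
  show ?thesis
    unfolding is_functor_def sized_RelSP_simps opposite_SLata_simps obj
  proof (intro conjI ballI; elim CollectE conjE)
    fix X :: "'x rels_space" assume X: "is_rels_space X" "sized_by TYPE('a) X"
    show "(coded X :: 'a slata) \<in> {A. is_slata A}"
      using slata_iso_is_slata[OF is_slata_slata_of[OF X(1)] slata_iso_code[OF X(2)]] by simp
    show "on_arr box_functor X X (dual_spec X) = restrict (\<lambda>a. a) (elems (coded X :: 'a slata))"
      by (rule on_arr_box_functor_eqI[OF X(2)]) (simp_all add: box_dual_spec elems_coded)
  next
    fix X Y :: "'x rels_space" and M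
    assume "is_rels_space X" "sized_by TYPE('a) X" "is_rels_space Y" "sized_by TYPE('a) Y"
      "adjoint_preserving X Y M"
    then show "on_arr box_functor X Y M \<in> slata_hom (coded Y :: 'a slata) (coded X)"
      by (rule on_arr_box_functor_in_slata_hom)
  next
    fix X Y Z :: "'x rels_space" and M N
    assume X: "is_rels_space X" "sized_by TYPE('a) X" and Y: "is_rels_space Y" "sized_by TYPE('a) Y"
      and Z: "is_rels_space Z" "sized_by TYPE('a) Z"
      and M: "adjoint_preserving X Y M" and N: "adjoint_preserving Y Z N"
    show "on_arr box_functor X Z (star X Z N M) =
        compose (elems (coded Z :: 'a slata)) (on_arr box_functor X Y M) (on_arr box_functor Y Z N)"
      by (rule on_arr_box_functor_eqI[OF Z(2)])
        (simp_all add: compose_def elems_coded adjoint_preserving_star(2)[OF X(1) Y(1) Z(1) M N]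
          on_arr_box_functor[OF Y(2)] on_arr_box_functor[OF Z(2)] adjoint_preserving_box[OF N])
  qed
qed

text \<open>The points are subsets of \<open>'a\<close>, but the subbase is indexed by elements of
  \<open>A\<close>; this is why the size condition bounds the subbase.\<close>

lemma sized_by_dual_space: "sized_by TYPE('a) (dual_space (A :: 'a slata))"
  unfolding sized_by_def dual_space_simps
  by (rule lepoll_trans[OF image_lepoll subset_imp_lepoll]) simp

theorem theorem3p2:
  shows "dually_equivalent
           (SLata :: ('a slata, 'a \<Rightarrow> 'a) category)
           (full_subcategory
              (RelSP :: ('a set rels_space, ('a set \<times> 'a set) set) category)
              (sized_by TYPE('a)))"
  unfolding dually_equivalent_def
\<comment> \<open>The explicit functor leaves RelSP, so the criterion is applied from that side and
  the equivalence is then turned around.\<close>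
proof (rule equivalent_sym,
    rule equivalent_if_fully_faithful_essentially_surjective[where F = box_functor])
  show "is_category (sized_RelSP TYPE('a) :: ('a set rels_space, _) category)"
    by (rule is_category_full_subcategory[OF is_category_RelSP])
  show "is_category (opposite (SLata :: ('a slata, _) category))"
    by (rule is_category_opposite[OF is_category_SLata])
  show "is_functor (sized_RelSP TYPE('a)) (opposite SLata)
      (box_functor :: ('a set rels_space, _, 'a slata, _) cat_functor)"
    by (rule is_functor_box_functor)
next
  fix X Y :: "'a set rels_space"
  assume "X \<in> Obj (sized_RelSP TYPE('a))" "Y \<in> Obj (sized_RelSP TYPE('a))"
  then have XY: "is_rels_space X" "sized_by TYPE('a) X" "is_rels_space Y" "sized_by TYPE('a) Y"
    by (simp_all add: sized_RelSP_simps)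
  have "on_arr box_functor X Y ` {M. adjoint_preserving X Y M} = slata_hom (coded Y :: 'a slata) (coded X)"
    using on_arr_box_functor_in_slata_hom[OF XY] on_arr_box_functor_surj[OF XY] by blast
  then show "bij_betw (on_arr box_functor X Y) (Hom (sized_RelSP TYPE('a)) X Y)
      (Hom (opposite (SLata :: ('a slata, _) category)) (on_obj box_functor X) (on_obj box_functor Y))"
    using inj_on_on_arr_box_functor[OF XY]
    by (simp add: bij_betw_def sized_RelSP_simps opposite_SLata_simps) (simp add: box_functor_def)
next
  fix A :: "'a slata" assume "A \<in> Obj (opposite SLata)"
  then have A: "is_slata A" by (simp add: opposite_SLata_simps)
  let ?X = "dual_space A"
  let ?h = "\<lambda>a. code ?X (beta A a) :: 'a"
  have h: "slata_iso A (coded ?X :: 'a slata) ?h"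
    by (rule slata_iso_comp[OF slata_iso_beta[OF A] slata_iso_code[OF sized_by_dual_space]])
  \<comment> \<open>An arrow out of \<open>A\<close> in the opposite category is a homomorphism into
    \<open>A\<close>, hence the inverse of \<open>?h\<close>.\<close>
  have "is_iso (opposite SLata) A (on_obj box_functor ?X)
      (restrict (inv_into (elems A) ?h) (elems (coded ?X :: 'a slata)))"
    using is_iso_SLata[OF slata_iso_is_slata[OF A h] slata_iso_inv[OF A h]]
    unfolding is_iso_opposite by (simp add: box_functor_def)
  then show "\<exists>X\<in>Obj (sized_RelSP TYPE('a) :: ('a set rels_space, _) category).
      \<exists>f. is_iso (opposite SLata) A (on_obj box_functor X) f"
    using is_rels_space_dual_space[OF A] sized_by_dual_space[of A]
    by (intro bexI[of _ ?X] exI) (simp_all add: sized_RelSP_simps)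
qed

end
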